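(* Let $u_0$ be an initial function and let $\omega(u_0)$ be the $\omega$-limit set of $u_0$ for Problem $(P)$. (i) Suppose $u_0\in L^\infty(\Omega)$, $u_0(x)\ge 1$ for a.e. $x\in\Omega$ and $u_0\not\equiv 1$. Then $\omega(u_0)$ contains exactly one element $\varphi$. Moreover $\varphi$ is a step function of the form $\varphi=\mu\chi_{A_1}+\chi_{\Omega\setminus A_1}$ for some (measurable) $A_1\subset\Omega$ and some constant $\mu>1$. (ii) Suppose $u_0\in L^\infty(\Omega)$, $u_0(x)\le 0$ for a.e. $x\in\Omega$ and $u_0\not\equiv 0$. Then $\omega(u_0)$ contains exactly one element $\psi$. Moreover $\psi$ is a step function of the form $\psi=\xi\chi_{A_1}$ for some (measurable) $A_1\subset\Omega$ and some constant $\xi<0$.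
   Context: Standing assumptions: $\Omega\subset\mathbb{R}^N$ ($N\ge1$) is an open bounded set; $p\in C^1(\mathbb{R})$ is strictly increasing on $\mathbb{R}$; $g\in C^1(\mathbb{R})$ satisfies $g(0)=g(1)=0$, $g>0$ on $(0,1)$ and $g<0$ on $(-\infty,0)\cup(1,\infty)$. For $v\in L^\infty(\Omega)$ with $\int_\Omega g(v)\ne0$ put $F(v):=g(v)p(v)-g(v)\dfrac{\int_\Omega g(v)p(v)}{\int_\Omega g(v)}$. Problem $(P)$ is the initial value problem $u_t=F(u)$, $t\ge0$, $u(x,0)=u_0(x)$, $x\in\Omega$. For $0<T\le\infty$, a function $u\in C^1([0,T);L^\infty(\Omega))$ is a solution of $(P)$ on $[0,T)$ if $u(0)=u_0$, $\int_\Omega g(u(t))\ne0$ for all $t\in[0,T)$, and $\frac{du}{dt}=F(u)$ on the whole interval $[0,T)$. Under the hypotheses of (i) or (ii), Problem $(P)$ has a unique solution $u$ on $[0,\infty)$, and the $\omega$-limit set is $\omega(u_0):=\{\varphi\in L^1(\Omega):\exists\, t_n\to\infty,\ u(t_n)\to\varphi \text{ in } L^1(\Omega)\text{ as } n\to\infty\}$. $\chi_A$ denotes the characteristic function of $A$. *)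

theory Defs
  imports "HOL-Analysis.Analysis" "HOL-Probability.Essential_Supremum"
begin

text \<open>
  Elements of \<open>L\<^sup>\<infinity>(\<Omega>)\<close> are represented by functions on the whole space, of which only the
  restriction to \<open>\<Omega>\<close> matters, and up to Lebesgue-null sets. The norm takes values in
  \<^typ>\<open>ennreal\<close>; it is \<open>\<infinity>\<close> on functions that are not measurable, because
  \<^const>\<open>esssup\<close> is then \<open>top\<close>.
\<close>

definition Linf_norm :: "'a::euclidean_space set \<Rightarrow> ('a \<Rightarrow> real) \<Rightarrow> ennreal" where
  "Linf_norm \<Omega> f = esssup (lebesgue_on \<Omega>) (\<lambda>x. ennreal \<bar>f x\<bar>)"

definition Linf_space :: "'a::euclidean_space set \<Rightarrow> ('a \<Rightarrow> real) set" where
  "Linf_space \<Omega> = {f \<in> borel_measurable (lebesgue_on \<Omega>). Linf_norm \<Omega> f < \<infinity>}"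

definition continuous_on_Linf :: "'a::euclidean_space set \<Rightarrow> real set \<Rightarrow> (real \<Rightarrow> 'a \<Rightarrow> real) \<Rightarrow> bool"
  where "continuous_on_Linf \<Omega> I u \<longleftrightarrow>
    (\<forall>t\<in>I. u t \<in> Linf_space \<Omega> \<and>
      ((\<lambda>s. Linf_norm \<Omega> (\<lambda>x. u s x - u t x)) \<longlongrightarrow> 0) (at t within I))"

definition has_Linf_derivative ::
    "'a::euclidean_space set \<Rightarrow> real set \<Rightarrow> (real \<Rightarrow> 'a \<Rightarrow> real) \<Rightarrow> ('a \<Rightarrow> real) \<Rightarrow> real \<Rightarrow> bool"
  where "has_Linf_derivative \<Omega> I u v t \<longleftrightarrow>
    v \<in> Linf_space \<Omega> \<and>
    ((\<lambda>s. Linf_norm \<Omega> (\<lambda>x. (u s x - u t x) / (s - t) - v x)) \<longlongrightarrow> 0) (at t within I)"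

definition C1_Linf :: "'a::euclidean_space set \<Rightarrow> real set \<Rightarrow> (real \<Rightarrow> 'a \<Rightarrow> real) \<Rightarrow> bool" where
  "C1_Linf \<Omega> I u \<longleftrightarrow>
    (\<forall>t\<in>I. u t \<in> Linf_space \<Omega>) \<and>
    (\<exists>u'. (\<forall>t\<in>I. has_Linf_derivative \<Omega> I u (u' t) t) \<and> continuous_on_Linf \<Omega> I u')"

definition F_op ::
    "'a::euclidean_space set \<Rightarrow> (real \<Rightarrow> real) \<Rightarrow> (real \<Rightarrow> real) \<Rightarrow> ('a \<Rightarrow> real) \<Rightarrow> 'a \<Rightarrow> real"
  where "F_op \<Omega> p g v x =
    g (v x) * p (v x) -
    g (v x) * ((\<integral>y. g (v y) * p (v y) \<partial>lebesgue_on \<Omega>) / (\<integral>y. g (v y) \<partial>lebesgue_on \<Omega>))"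

definition time_interval :: "ereal \<Rightarrow> real set" where
  "time_interval T = {t. 0 \<le> t \<and> ereal t < T}"

definition solution_P ::
    "'a::euclidean_space set \<Rightarrow> (real \<Rightarrow> real) \<Rightarrow> (real \<Rightarrow> real) \<Rightarrow> ('a \<Rightarrow> real) \<Rightarrow> ereal
      \<Rightarrow> (real \<Rightarrow> 'a \<Rightarrow> real) \<Rightarrow> bool"
  where "solution_P \<Omega> p g u0 T u \<longleftrightarrow>
    0 < T \<and>
    C1_Linf \<Omega> (time_interval T) u \<and>
    (AE x in lebesgue_on \<Omega>. u 0 x = u0 x) \<and>
    (\<forall>t\<in>time_interval T. (\<integral>x. g (u t x) \<partial>lebesgue_on \<Omega>) \<noteq> 0) \<and>
    (\<forall>t\<in>time_interval T. has_Linf_derivative \<Omega> (time_interval T) u (F_op \<Omega> p g (u t)) t)"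

text \<open>
  The element of \<open>L\<^sup>1(\<Omega>)\<close> represented by \<open>f\<close>. The \<open>\<omega>\<close>-limit set is a set of such classes,
  so that counting its elements has the intended meaning.
\<close>

definition L1_class :: "'a::euclidean_space set \<Rightarrow> ('a \<Rightarrow> real) \<Rightarrow> ('a \<Rightarrow> real) set" where
  "L1_class \<Omega> f = {h. integrable (lebesgue_on \<Omega>) h \<and> (AE x in lebesgue_on \<Omega>. h x = f x)}"

definition omega_limit ::
    "'a::euclidean_space set \<Rightarrow> (real \<Rightarrow> 'a \<Rightarrow> real) \<Rightarrow> ('a \<Rightarrow> real) set set"
  where "omega_limit \<Omega> u = {L1_class \<Omega> \<phi> | \<phi>.
    integrable (lebesgue_on \<Omega>) \<phi> \<and>
    (\<exists>t :: nat \<Rightarrow> real. (\<forall>n. 0 \<le> t n) \<and> filterlim t at_top sequentially \<and>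
      (\<lambda>n. \<integral>\<^sup>+x. ennreal \<bar>u (t n) x - \<phi> x\<bar> \<partial>lebesgue_on \<Omega>) \<longlonglongrightarrow> 0)}"

end

theory Submission
  imports Defs
begin

text \<open>
  For a \<open>C\<^sup>1\<close> function \<open>f\<close> and a measurable set \<open>B\<close>, the functional \<open>\<integral>\<^sub>B f(u(t))\<close> is differentiable
  with derivative \<open>\<integral>\<^sub>B f'(u) F(u)\<close>, so the flow can be studied without solving the equation pointwise.
  Suppose \<open>u\<^sub>0 \<ge> 1\<close>. Gronwall's inequality shows that \<open>u \<ge> 1\<close> and that \<open>u = 1\<close> persists outside
  \<open>A = {u\<^sub>0 > 1}\<close>. The nonlocal term \<open>\<lambda>(t)\<close> is then a weighted mean of \<open>p(u)\<close> and equals \<open>p(s)\<close> for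
  some \<open>s = s(t)\<close>; Chebyshev's inequality makes every convex integral of \<open>u\<close> nonincreasing, so \<open>u\<close>
  stays bounded and \<open>\<integral>u\<close> is constant. Conservation of \<open>\<integral>u\<close> keeps \<open>\<lambda>(t)\<close> away from \<open>p(1)\<close>, which
  pushes the values near \<open>1\<close> upwards: \<open>\<integral>\<^sub>A (1+d-u)\<^sub>+\<^sup>2 \<rightarrow> 0\<close> for some \<open>d > 0\<close>. With \<open>\<mu>\<close> the (constant)
  mean of \<open>u\<close> over \<open>A\<close>, compactness gives \<open>(u-s)\<^sup>2 \<le> q + C ((u-s) (p(u)-p(s)) \<bar>g(u)\<bar> + (1+d-u)\<^sub>+\<^sup>2)\<close>.
  Integrated over \<open>A\<close>, this is a differential inequality which forces \<open>H(t) = \<integral>\<^sub>A (u-\<mu>)\<^sup>2\<close> to tend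
  to \<open>0\<close>. If \<open>u\<^sub>0 \<le> 0\<close>, then \<open>1 - u\<close> solves the problem with \<open>g(1 - \<cdot>)\<close> and \<open>- p(1 - \<cdot>)\<close>.
\<close>

section \<open>Tools from real analysis\<close>

text \<open>Gronwall's inequality: \<open>exp (- C * t) * E t\<close> is nonincreasing on the
  interval. The sign of \<open>C\<close> is free: a positive rate propagates zeros, rate 0 gives
  monotone functionals, a negative rate gives exponential decay.\<close>

lemma exp_decay_of_derivative_le:
  fixes E E' :: "real \<Rightarrow> real"
  assumes der: "\<And>t. 0 \<le> t \<Longrightarrow> (E has_real_derivative E' t) (at t within {0..})"
    and le: "\<And>t. S \<le> t \<Longrightarrow> t \<le> T \<Longrightarrow> E' t \<le> C * E t"
    and T: "0 \<le> S" "S \<le> T"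
  shows "E T \<le> exp (C * (T - S)) * E S"
proof -
  let ?G = "\<lambda>t. exp (- C * t) * E t"
  have G: "(?G has_real_derivative exp (- C * t) * (E' t - C * E t)) (at t within {0..})"
    if "0 \<le> t" for t
    by (rule derivative_eq_intros der that refl | simp add: algebra_simps)+
  have "?G T \<le> ?G S"
  proof (rule DERIV_nonpos_imp_decreasing_open[OF T(2)])
    fix x assume x: "S < x" "x < T"
    then have "at x within {0..} = at x"
      using T by (intro at_within_interior) auto
    then have "(?G has_real_derivative exp (- C * x) * (E' x - C * E x)) (at x)"
      using G[of x] x T by simp
    moreover have "exp (- C * x) * (E' x - C * E x) \<le> 0"
      using le[of x] x by (simp add: mult_le_0_iff)
    ultimately show "\<exists>y. (?G has_real_derivative y) (at x) \<and> y \<le> 0" by blast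
  next
    have "continuous_on {0..} ?G"
      using G by (intro DERIV_continuous_on) auto
    then show "continuous_on {S..T} ?G"
      by (rule continuous_on_subset) (use T in auto)
  qed
  then have "exp (C * T) * (exp (- C * T) * E T) \<le> exp (C * T) * (exp (- C * S) * E S)"
    by (intro mult_left_mono) auto
  moreover have "exp (C * T) * (exp (- C * T) * E T) = E T"
    by (simp add: mult.assoc[symmetric] exp_add[symmetric])
  moreover have "exp (C * T) * (exp (- C * S) * E S) = exp (C * (T - S)) * E S"
    by (simp add: mult.assoc[symmetric] exp_add[symmetric] right_diff_distrib)
  ultimately show ?thesis by (metis (lifting))
qed

lemma exp_decay_tendsto_0:
  fixes c :: real
  assumes "0 < c"
  shows "((\<lambda>t. exp (- c * t) * E) \<longlongrightarrow> 0) at_top"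
proof -
  have "filterlim (\<lambda>t. c * t) at_top at_top"
    using assms by (rule filterlim_tendsto_pos_mult_at_top[OF tendsto_const _ filterlim_ident])
  then have "filterlim (\<lambda>t. - c * t) at_bot at_top" by (simp add: filterlim_uminus_at_bot)
  from filterlim_compose[OF exp_at_bot this] show ?thesis by (rule tendsto_mult_left_zero)
qed

text \<open>By the mean value theorem the remainder is \<open>(f' z - f' b) * (a - b)\<close> with
  \<open>z\<close> between \<open>a\<close> and \<open>b\<close>, and \<open>f'\<close> is uniformly
  continuous on the compact interval. A single \<open>d\<close> for all \<open>a\<close> and
  \<open>b\<close> lets the expansion be integrated over space.\<close>

lemma uniform_first_order_expansion:
  fixes f f' :: "real \<Rightarrow> real"
  assumes der: "\<And>s. (f has_real_derivative f' s) (at s)"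
    and cont: "continuous_on UNIV f'" and e: "0 < e"
  shows "\<exists>d>0. \<forall>a\<in>{-K..K}. \<forall>b\<in>{-K..K}. \<bar>a - b\<bar> < d \<longrightarrow>
    \<bar>f a - f b - f' b * (a - b)\<bar> \<le> e * \<bar>a - b\<bar>"
proof -
  have "uniformly_continuous_on {-K..K} f'"
    using cont by (intro compact_uniformly_continuous) (auto intro: continuous_on_subset)
  then obtain d where d: "d > 0"
    "\<And>x y. x \<in> {-K..K} \<Longrightarrow> y \<in> {-K..K} \<Longrightarrow> dist y x < d \<Longrightarrow> dist (f' y) (f' x) < e"
    unfolding uniformly_continuous_on_def using e by blast
  have "\<bar>f a - f b - f' b * (a - b)\<bar> \<le> e * \<bar>a - b\<bar>"
    if ab: "a \<in> {-K..K}" "b \<in> {-K..K}" "\<bar>a - b\<bar> < d" for a b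
  proof -
    have "\<exists>z. z \<in> {-K..K} \<and> \<bar>z - b\<bar> < d \<and> f a - f b = f' z * (a - b)"
    proof (cases a b rule: linorder_cases)
      case less
      from MVT2[OF this der] obtain z where "a < z" "z < b" "f b - f a = (b - a) * f' z" by blast
      then show ?thesis using ab by (intro exI[of _ z]) (auto simp: algebra_simps)
    next
      case equal
      then show ?thesis using ab d by (intro exI[of _ b]) auto
    next
      case greater
      from MVT2[OF this der] obtain z where "b < z" "z < a" "f a - f b = (a - b) * f' z" by blast
      then show ?thesis using ab by (intro exI[of _ z]) (auto simp: algebra_simps)
    qed
    then obtain z where z: "z \<in> {-K..K}" "\<bar>z - b\<bar> < d" "f a - f b = f' z * (a - b)" by blast
    have "\<bar>f' z - f' b\<bar> \<le> e"
      using d(2)[of b z] z ab by (auto simp: dist_real_def)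
    then have "\<bar>f' z - f' b\<bar> * \<bar>a - b\<bar> \<le> e * \<bar>a - b\<bar>" by (intro mult_right_mono) auto
    then show ?thesis
      unfolding z(3) by (simp add: abs_mult[symmetric] algebra_simps)
  qed
  with d(1) show ?thesis by blast
qed

lemma continuous_bounded_on_interval:
  fixes f :: "real \<Rightarrow> real"
  assumes "continuous_on {a..b} f"
  shows "\<exists>C\<ge>0. \<forall>s\<in>{a..b}. \<bar>f s\<bar> \<le> C"
proof -
  have "bounded (f ` {a..b})"
    using assms by (intro compact_imp_bounded compact_continuous_image) auto
  then obtain C where "\<forall>y\<in>f ` {a..b}. \<bar>y\<bar> \<le> C"
    unfolding bounded_iff by auto
  then have "\<forall>s\<in>{a..b}. \<bar>f s\<bar> \<le> max C 0" by (auto intro: max.coboundedI1)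
  then show ?thesis by (meson max.cobounded2)
qed

text \<open>The squared positive part is a penalty for crossing a level. Unlike the positive part
  itself it is C1, so its integral along the flow can be differentiated.\<close>

lemma has_real_derivative_max_square:
  "((\<lambda>s. (max 0 s)\<^sup>2) has_real_derivative 2 * max 0 s) (at s)" for s :: real
proof (cases s "0::real" rule: linorder_cases)
  case less
  have "((\<lambda>s. 0) has_real_derivative 2 * max 0 s) (at s)" using less by simp
  then show ?thesis
    by (rule has_field_derivative_transform_within[where d = "- s"])
      (use less in \<open>auto simp: dist_real_def\<close>)
next
  case equal
  have "((\<lambda>h::real. \<bar>h\<bar>) \<longlongrightarrow> 0) (at 0)"
    by (rule tendsto_eq_intros | simp)+
  then have "((\<lambda>h::real. ((max 0 h)\<^sup>2) / h) \<longlongrightarrow> 0) (at 0)"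
    by (rule Lim_null_comparison[rotated])
       (auto simp: eventually_at_filter max_def power2_eq_square)
  then show ?thesis using equal by (simp add: DERIV_def)
next
  case greater
  have "((\<lambda>s. s\<^sup>2) has_real_derivative 2 * max 0 s) (at s)"
    using greater by (auto intro!: derivative_eq_intros)
  then show ?thesis
    by (rule has_field_derivative_transform_within[where d = s])
      (use greater in \<open>auto simp: dist_real_def\<close>)
qed

lemma has_real_derivative_max_square_diff:
  "((\<lambda>s. (max 0 (a - s))\<^sup>2) has_real_derivative - 2 * max 0 (a - s)) (at s)"
  "((\<lambda>s. (max 0 (s - a))\<^sup>2) has_real_derivative 2 * max 0 (s - a)) (at s)" for a s :: real
proof -
  have "((\<lambda>s. a - s) has_real_derivative - 1) (at s)" "((\<lambda>s. s - a) has_real_derivative 1) (at s)"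
    by (auto intro!: derivative_eq_intros)
  from this[THEN DERIV_chain2[OF has_real_derivative_max_square]]
  show "((\<lambda>s. (max 0 (a - s))\<^sup>2) has_real_derivative - 2 * max 0 (a - s)) (at s)"
    "((\<lambda>s. (max 0 (s - a))\<^sup>2) has_real_derivative 2 * max 0 (s - a)) (at s)"
    by simp_all
qed

lemma (in finite_measure) abs_integral_le_AE_bound:
  fixes f :: "'a \<Rightarrow> real"
  assumes "integrable M f" "AE x in M. \<bar>f x\<bar> \<le> c"
  shows "\<bar>integral\<^sup>L M f\<bar> \<le> c * measure M (space M)"
proof -
  have "\<bar>integral\<^sup>L M f\<bar> \<le> (\<integral>x. \<bar>f x\<bar> \<partial>M)" by simp
  also have "\<dots> \<le> (\<integral>x. c \<partial>M)"
    using assms by (intro integral_mono_AE) auto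
  finally show ?thesis by (simp add: mult.commute)
qed

text \<open>Where \<open>a \<ge> e\<close>, the function \<open>b\<close> has a positive minimum, so a multiple of \<open>b\<close> dominates \<open>a\<close> there.\<close>
lemma compact_interpolation_le:
  fixes a b :: "'b::t2_space \<Rightarrow> real"
  assumes S: "compact S" and a: "continuous_on S a" and b: "continuous_on S b"
    and nn: "\<And>x. x \<in> S \<Longrightarrow> 0 \<le> b x"
    and zero: "\<And>x. x \<in> S \<Longrightarrow> b x = 0 \<Longrightarrow> a x \<le> 0" and e: "0 < e"
  shows "\<exists>C>0. \<forall>x\<in>S. a x \<le> e + C * b x"
proof -
  let ?S = "S \<inter> a -` {e..}"
  have "closed ?S"
    using continuous_closed_preimage[OF a compact_imp_closed[OF S] closed_atLeast] by simp
  then have S': "compact ?S" using compact_Int_closed[OF S, of ?S] by (simp add: Int_absorb1)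
  show ?thesis
  proof (cases "?S = {}")
    case True
    then have "a x \<le> e + 1 * b x" if "x \<in> S" for x using nn[OF that] that by force
    then show ?thesis by (intro exI[of _ 1]) auto
  next
    case False
    obtain y where y: "y \<in> ?S" "\<And>x. x \<in> ?S \<Longrightarrow> b y \<le> b x"
      using continuous_attains_inf[OF S' False, of b] b continuous_on_subset by blast
    obtain z where z: "z \<in> ?S" "\<And>x. x \<in> ?S \<Longrightarrow> a x \<le> a z"
      using continuous_attains_sup[OF S' False, of a] a continuous_on_subset by blast
    have bpos: "0 < b y" using y(1) nn[of y] zero[of y] e by fastforce
    have az: "0 < a z" using z(1) e by auto
    have "a x \<le> e + a z / b y * b x" if x: "x \<in> S" for x
    proof (cases "x \<in> ?S")
      case True
      have "a x \<le> a z / b y * b y" using z(2)[OF True] bpos by simp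
      also have "\<dots> \<le> a z / b y * b x" using y(2)[OF True] az bpos by (intro mult_left_mono) auto
      finally show ?thesis using e by simp
    next
      case False
      then have "a x \<le> e" using x by auto
      moreover have "0 \<le> a z / b y * b x" using bpos az nn[OF x] by simp
      ultimately show ?thesis by linarith
    qed
    then show ?thesis using bpos az by (intro exI[of _ "a z / b y"]) auto
  qed
qed

subsection \<open>The nonlocal flow above the value 1\<close>

text \<open>The hypotheses are shared by \<open>g\<close>, \<open>p\<close> and by the reflected
  pair \<open>g (1 - s)\<close>, \<open>- p (1 - s)\<close>, so that both cases are instances. The
  equation enters as \<open>u_deriv\<close>, a first-order expansion in time that is uniform in
  space off a null set, which may depend on \<open>s\<close>.\<close>

locale nonlocal_flow = finite_measure M for M :: "'a measure" +
  fixes u :: "real \<Rightarrow> 'a \<Rightarrow> real" and g g' p p' :: "real \<Rightarrow> real"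
    and lam :: "real \<Rightarrow> real" and F :: "real \<Rightarrow> 'a \<Rightarrow> real"
  defines "lam \<equiv> \<lambda>t. (\<integral>x. g (u t x) * p (u t x) \<partial>M) / (\<integral>x. g (u t x) \<partial>M)"
    and "F \<equiv> \<lambda>t x. g (u t x) * (p (u t x) - lam t)"
  assumes g_deriv: "\<And>s. (g has_real_derivative g' s) (at s)"
    and g'_cont: "continuous_on UNIV g'"
    and p_deriv: "\<And>s. (p has_real_derivative p' s) (at s)"
    and p'_cont: "continuous_on UNIV p'"
    and p_mono: "strict_mono p"
    and g_one: "g 1 = 0"
    and g_neg: "\<And>s. 1 < s \<Longrightarrow> g s < 0"
    and u_meas: "\<And>t. 0 \<le> t \<Longrightarrow> u t \<in> borel_measurable M"
    and u_bounded: "\<And>t. 0 \<le> t \<Longrightarrow> \<exists>K. AE x in M. \<bar>u t x\<bar> \<le> K"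
    and g_nonzero: "\<And>t. 0 \<le> t \<Longrightarrow> (\<integral>x. g (u t x) \<partial>M) \<noteq> 0"
    and u_deriv: "\<And>t e. 0 \<le> t \<Longrightarrow> 0 < e \<Longrightarrow> \<exists>d>0. \<forall>s\<ge>0. \<bar>s - t\<bar> < d \<longrightarrow>
      (AE x in M. \<bar>u s x - u t x - (s - t) * F t x\<bar> \<le> e * \<bar>s - t\<bar>)"
    and u_init: "AE x in M. 1 \<le> u 0 x"
    and u_init_nontrivial: "\<not> (AE x in M. u 0 x = 1)"
begin

section \<open>Integral functionals of the flow and their time derivatives\<close>

lemma g_cont: "continuous_on S g"
  by (rule DERIV_continuous_on[OF has_field_derivative_at_within[OF g_deriv]])

lemma p_cont: "continuous_on S p"
  by (rule DERIV_continuous_on[OF has_field_derivative_at_within[OF p_deriv]])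

lemma bounded_comp:
  fixes f :: "real \<Rightarrow> real"
  assumes "continuous_on UNIV f" "0 \<le> t"
  shows "\<exists>C\<ge>0. AE x in M. \<bar>f (u t x)\<bar> \<le> C"
proof -
  obtain K where K: "AE x in M. \<bar>u t x\<bar> \<le> K" using u_bounded assms by blast
  obtain C where C: "C \<ge> 0" "\<forall>s\<in>{-K..K}. \<bar>f s\<bar> \<le> C"
    using continuous_bounded_on_interval[of "-K" K f] assms continuous_on_subset by blast
  have "AE x in M. \<bar>f (u t x)\<bar> \<le> C" using K by eventually_elim (intro C(2)[rule_format], auto)
  with C(1) show ?thesis by blast
qed

lemma measurable_comp:
  fixes f :: "real \<Rightarrow> real"
  assumes "continuous_on UNIV f" "0 \<le> t"
  shows "(\<lambda>x. f (u t x)) \<in> borel_measurable M"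
  by (rule measurable_compose[OF u_meas[OF assms(2)] borel_measurable_continuous_onI[OF assms(1)]])

lemma integrable_comp:
  fixes f :: "real \<Rightarrow> real"
  assumes "continuous_on UNIV f" "0 \<le> t"
  shows "integrable M (\<lambda>x. f (u t x))"
proof -
  obtain C where "AE x in M. \<bar>f (u t x)\<bar> \<le> C" using bounded_comp[OF assms] by blast
  then show ?thesis
    by (intro integrable_const_bound[of _ C]) (auto intro: measurable_comp assms)
qed

lemma integrable_indicator_comp:
  fixes f :: "real \<Rightarrow> real"
  assumes "continuous_on UNIV f" "0 \<le> t" "B \<in> sets M"
  shows "integrable M (\<lambda>x. indicat_real B x * f (u t x))"
  using integrable_mult_indicator[OF assms(3) integrable_comp[OF assms(1,2)]] by simp

lemma F_alt: "F t x = (\<lambda>s. g s * (p s - lam t)) (u t x)"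
  by (simp add: F_def)

lemma F_fun_cont: "continuous_on UNIV (\<lambda>s. g s * (p s - c))"
  by (intro continuous_intros g_cont p_cont)

text \<open>Both \<open>u\<close> and \<open>f\<close> expand to first order uniformly,
  \<open>u\<close> off a null set and \<open>f\<close> on the bounded range of \<open>u\<close>;
  over a finite measure the integrated remainder is therefore of smaller order than
  \<open>s - t\<close>. The null set may change with \<open>s\<close>, since only integrals are
  compared. At \<open>t = 0\<close> the derivative is one-sided.\<close>

lemma has_derivative_integral_comp:
  assumes der: "\<And>s. (f has_real_derivative f' s) (at s)"
    and cont: "continuous_on UNIV f'" and B: "B \<in> sets M" and t: "0 \<le> t"
  shows "((\<lambda>t. \<integral>x. indicat_real B x * f (u t x) \<partial>M) has_real_derivative
    (\<integral>x. indicat_real B x * (f' (u t x) * F t x) \<partial>M)) (at t within {0..})"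
proof -
  let ?E = "\<lambda>t. \<integral>x. indicat_real B x * f (u t x) \<partial>M"
  let ?D = "\<integral>x. indicat_real B x * (f' (u t x) * F t x) \<partial>M"
  have f_cont: "continuous_on UNIV f"
    by (rule DERIV_continuous_on[OF has_field_derivative_at_within[OF der]])
  have intf: "integrable M (\<lambda>x. indicat_real B x * f (u s x))" if "0 \<le> s" for s
    by (rule integrable_indicator_comp[OF f_cont that B])
  have intD: "integrable M (\<lambda>x. indicat_real B x * (f' (u t x) * F t x))"
    using integrable_indicator_comp[OF continuous_on_mult[OF cont F_fun_cont] t B]
    unfolding F_alt by simp
  have "\<exists>d>0. \<forall>s\<in>{0..}. norm (s - t) < d \<longrightarrow>
      norm (?E s - ?E t - (s - t) * ?D) \<le> e * norm (s - t)" if e: "0 < e" for e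
  proof -
    obtain K where K: "AE x in M. \<bar>u t x\<bar> \<le> K" using u_bounded t by blast
    obtain C where C: "C \<ge> 0" "AE x in M. \<bar>F t x\<bar> \<le> C"
      using bounded_comp[OF F_fun_cont t] unfolding F_alt by blast
    obtain C1 where C1: "C1 \<ge> 0" "AE x in M. \<bar>f' (u t x)\<bar> \<le> C1"
      using bounded_comp[OF cont t] by blast
    let ?m = "measure M (space M)"
    \<comment> \<open>The tolerance for both expansions, small enough that the total remainder
      factor \<open>r * (C + 1 + C1) * ?m\<close> stays below \<open>e\<close>. The added ones keep
      the denominator positive, and \<open>r \<le> 1\<close> gives
      \<open>\<bar>u s x - u t x\<bar> \<le> (C + 1) * \<bar>s - t\<bar>\<close>.\<close>
    define r where "r = min 1 (e / ((C + 1 + C1) * (?m + 1)))"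
    have m: "?m \<ge> 0" by simp
    have pos: "0 < (C + 1 + C1) * (?m + 1)"
      using C(1) C1(1) m by (intro mult_pos_pos) linarith+
    then have r: "0 < r" "r \<le> 1"
      using e unfolding r_def by (simp_all only: min_less_iff_conj divide_pos_pos zero_less_one min.cobounded1)
    have "r * ((C + 1 + C1) * (?m + 1)) \<le> e / ((C + 1 + C1) * (?m + 1)) * ((C + 1 + C1) * (?m + 1))"
      using pos unfolding r_def by (intro mult_right_mono) auto
    also have "\<dots> = e"
      using less_imp_neq[OF pos] by (intro nonzero_eq_divide_eq[THEN iffD1]) auto
    finally have "r * ((C + 1 + C1) * (?m + 1)) \<le> e" .
    moreover have "r * ((C + 1 + C1) * ?m) \<le> r * ((C + 1 + C1) * (?m + 1))"
      using C(1) C1(1) m r by (intro mult_left_mono) auto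
    ultimately have re: "r * (C + 1 + C1) * ?m \<le> e" by (simp add: mult.assoc)
    obtain d1 where d1: "d1 > 0" "\<And>a b. \<bar>a\<bar> \<le> K + 1 \<Longrightarrow> \<bar>b\<bar> \<le> K + 1 \<Longrightarrow> \<bar>a - b\<bar> < d1 \<Longrightarrow>
        \<bar>f a - f b - f' b * (a - b)\<bar> \<le> r * \<bar>a - b\<bar>"
      using uniform_first_order_expansion[OF der cont r(1), of "K + 1"] by (auto simp: abs_le_iff)
    obtain d2 where d2: "d2 > 0" "\<And>s. 0 \<le> s \<Longrightarrow> \<bar>s - t\<bar> < d2 \<Longrightarrow>
        AE x in M. \<bar>u s x - u t x - (s - t) * F t x\<bar> \<le> r * \<bar>s - t\<bar>"
      using u_deriv[OF t r(1)] by blast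
    \<comment> \<open>The two quotients keep the increment of \<open>u\<close> below
      \<open>d1\<close>, where the expansion of \<open>f\<close> is valid, and below 1, so that
      \<open>u s\<close> stays within \<open>K + 1\<close>.\<close>
    define d where "d = min d2 (min (d1 / (C + 1)) (1 / (C + 1)))"
    have "d > 0" using d1(1) d2(1) C(1) by (simp add: d_def)
    moreover have "\<bar>?E s - ?E t - (s - t) * ?D\<bar> \<le> e * \<bar>s - t\<bar>"
      if s: "0 \<le> s" "\<bar>s - t\<bar> < d" for s
    proof -
      let ?R = "\<lambda>x. indicat_real B x * f (u s x) - indicat_real B x * f (u t x)
        - (s - t) * (indicat_real B x * (f' (u t x) * F t x))"
      have intR: "integrable M ?R"
        by (intro Bochner_Integration.integrable_diff intf s t integrable_mult_right intD)
      have sd: "\<bar>s - t\<bar> < d2" using s(2) by (simp add: d_def)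
      have st: "(C + 1) * \<bar>s - t\<bar> < d1" "(C + 1) * \<bar>s - t\<bar> < 1"
        using s(2) C(1) by (simp_all add: d_def field_simps)
      have "AE x in M. \<bar>?R x\<bar> \<le> r * (C + 1 + C1) * \<bar>s - t\<bar>"
        using K C(2) C1(2) d2(2)[OF s(1) sd]
      proof eventually_elim
        case (elim x)
        let ?a = "u s x" and ?b = "u t x" and ?h = "\<bar>s - t\<bar>"
        have "\<bar>(s - t) * F t x\<bar> \<le> C * ?h"
          using mult_right_mono[OF elim(2), of ?h] by (simp add: abs_mult mult.commute)
        moreover have "r * ?h \<le> 1 * ?h" using r by (intro mult_right_mono) auto
        ultimately have ab: "\<bar>?a - ?b\<bar> \<le> (C + 1) * ?h"
          using elim(4) by (simp add: algebra_simps)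
        have "\<bar>f ?a - f ?b - f' ?b * (?a - ?b)\<bar> \<le> r * \<bar>?a - ?b\<bar>"
          using ab st elim(1) by (intro d1(2)) linarith+
        also have "\<dots> \<le> r * ((C + 1) * ?h)" using ab r by (intro mult_left_mono) auto
        finally have 1: "\<bar>f ?a - f ?b - f' ?b * (?a - ?b)\<bar> \<le> r * ((C + 1) * ?h)" .
        have 2: "\<bar>f' ?b * (?a - ?b - (s - t) * F t x)\<bar> \<le> C1 * (r * ?h)"
          unfolding abs_mult using elim C1(1) by (intro mult_mono) auto
        \<comment> \<open>The error splits into the remainder of \<open>f\<close> and
          \<open>f'\<close> times the remainder of \<open>u\<close>.\<close>
        have eq: "f ?a - f ?b - (s - t) * (f' ?b * F t x) =
          (f ?a - f ?b - f' ?b * (?a - ?b)) + f' ?b * (?a - ?b - (s - t) * F t x)"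
          by (simp add: algebra_simps)
        have "\<bar>f ?a - f ?b - (s - t) * (f' ?b * F t x)\<bar> \<le> r * ((C + 1) * ?h) + C1 * (r * ?h)"
          unfolding eq using abs_triangle_ineq 1 2 by (meson add_mono order_trans)
        also have "\<dots> = r * (C + 1 + C1) * ?h" by (simp add: algebra_simps)
        finally show ?case using r C(1) C1(1) by (auto simp: indicator_def)
      qed
      from abs_integral_le_AE_bound[OF intR this]
      have "\<bar>integral\<^sup>L M ?R\<bar> \<le> (r * (C + 1 + C1) * ?m) * \<bar>s - t\<bar>" by (simp add: algebra_simps)
      also have "\<dots> \<le> e * \<bar>s - t\<bar>" using re by (intro mult_right_mono) auto
      also have "integral\<^sup>L M ?R = ?E s - ?E t - (s - t) * ?D"
        by (subst Bochner_Integration.integral_diff Bochner_Integration.integral_diff[OF intf[OF s(1)] intf[OF t]],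
            (intro Bochner_Integration.integrable_diff intf s t integrable_mult_right intD)+)
          (simp only: Bochner_Integration.integral_mult_right_zero
             Bochner_Integration.integral_diff[OF intf[OF s(1)] intf[OF t]])
      finally show ?thesis .
    qed
    ultimately show ?thesis by auto
  qed
  then show ?thesis
    unfolding has_field_derivative_def has_derivative_within_alt
    by (auto intro: bounded_linear_mult_right simp: mult.commute[of _ ?D])
qed

lemma has_derivative_integral_comp_UNIV:
  assumes der: "\<And>s. (f has_real_derivative f' s) (at s)"
    and cont: "continuous_on UNIV f'" and t: "0 \<le> t"
  shows "((\<lambda>t. \<integral>x. f (u t x) \<partial>M) has_real_derivative
    (\<integral>x. f' (u t x) * F t x \<partial>M)) (at t within {0..})"
proof -
  have "(\<integral>x. indicat_real (space M) x * h x \<partial>M) = (\<integral>x. h x \<partial>M)" for h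
    by (intro Bochner_Integration.integral_cong) auto
  then show ?thesis
    using has_derivative_integral_comp[OF der cont sets.top t] by simp
qed

section \<open>Bounds on finite time intervals\<close>

text \<open>Bolzano's bisection principle glues local bounds: near each time the first-order
  expansion bounds \<open>u s\<close> in terms of \<open>u t\<close>. The bound \<open>K\<close> is
  uniform in time, while the null set may vary with \<open>t\<close>.\<close>

lemma u_bounded_interval:
  assumes "0 \<le> T"
  shows "\<exists>K. \<forall>t\<in>{0..T}. AE x in M. \<bar>u t x\<bar> \<le> K"
proof -
  have "\<exists>K. \<forall>t\<in>{0..T}. 0 \<le> t \<longrightarrow> (AE x in M. \<bar>u t x\<bar> \<le> K)"
  proof (rule Bolzano[of 0 T "\<lambda>a b. \<exists>K. \<forall>t\<in>{a..b}. 0 \<le> t \<longrightarrow> (AE x in M. \<bar>u t x\<bar> \<le> K)", OF assms])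
    fix a b c :: real
    assume "\<exists>K. \<forall>t\<in>{a..b}. 0 \<le> t \<longrightarrow> (AE x in M. \<bar>u t x\<bar> \<le> K)"
      "\<exists>K. \<forall>t\<in>{b..c}. 0 \<le> t \<longrightarrow> (AE x in M. \<bar>u t x\<bar> \<le> K)"
    then obtain K1 K2 where K: "\<forall>t\<in>{a..b}. 0 \<le> t \<longrightarrow> (AE x in M. \<bar>u t x\<bar> \<le> K1)"
      "\<forall>t\<in>{b..c}. 0 \<le> t \<longrightarrow> (AE x in M. \<bar>u t x\<bar> \<le> K2)" by blast
    have "AE x in M. \<bar>u t x\<bar> \<le> max K1 K2" if t: "t \<in> {a..c}" "0 \<le> t" for t
    proof -
      have "(AE x in M. \<bar>u t x\<bar> \<le> K1) \<or> (AE x in M. \<bar>u t x\<bar> \<le> K2)"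
        using K t by (cases "t \<le> b") auto
      then show ?thesis by (auto elim!: eventually_mono)
    qed
    then show "\<exists>K. \<forall>t\<in>{a..c}. 0 \<le> t \<longrightarrow> (AE x in M. \<bar>u t x\<bar> \<le> K)" by blast
  next
    fix t :: real assume t: "0 \<le> t"
    obtain K where K: "AE x in M. \<bar>u t x\<bar> \<le> K" using u_bounded t by blast
    obtain C where C: "AE x in M. \<bar>F t x\<bar> \<le> C"
      using bounded_comp[OF F_fun_cont t] unfolding F_alt by blast
    obtain d where d: "d > 0" "\<And>s. 0 \<le> s \<Longrightarrow> \<bar>s - t\<bar> < d \<Longrightarrow>
        AE x in M. \<bar>u s x - u t x - (s - t) * F t x\<bar> \<le> 1 * \<bar>s - t\<bar>"
      using u_deriv[OF t zero_less_one] by blast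
    have "AE x in M. \<bar>u s x\<bar> \<le> K + d * \<bar>C\<bar> + d" if s: "0 \<le> s" "\<bar>s - t\<bar> < d" for s
      using K C d(2)[OF s]
    proof eventually_elim
      case (elim x)
      define h where "h = (s - t) * F t x"
      have "\<bar>h\<bar> \<le> d * \<bar>C\<bar>"
        unfolding abs_mult h_def using s elim by (intro mult_mono) auto
      moreover have "\<bar>u s x\<bar> \<le> \<bar>u t x\<bar> + \<bar>h\<bar> + \<bar>u s x - u t x - h\<bar>" by linarith
      ultimately show ?case using elim(1,3) s unfolding h_def[symmetric] by simp
    qed
    then have "\<forall>s\<in>{a..b}. 0 \<le> s \<longrightarrow> (AE x in M. \<bar>u s x\<bar> \<le> K + d * \<bar>C\<bar> + d)"
      if "a \<le> t \<and> t \<le> b \<and> b - a < d" for a b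
      using that by auto
    then show "\<exists>d>0. \<forall>a b. a \<le> t \<and> t \<le> b \<and> b - a < d \<longrightarrow>
        (\<exists>K. \<forall>t\<in>{a..b}. 0 \<le> t \<longrightarrow> (AE x in M. \<bar>u t x\<bar> \<le> K))"
      using d(1) by blast
  qed
  then show ?thesis by auto
qed

text \<open>The quotient \<open>lam\<close> is exactly the multiplier for which the source term has
  zero total mass.\<close>

lemma integral_F: 
  assumes "0 \<le> t"
  shows "(\<integral>x. F t x \<partial>M) = 0"
proof -
  have "(\<integral>x. F t x \<partial>M) = (\<integral>x. g (u t x) * p (u t x) - lam t * g (u t x) \<partial>M)"
    by (simp add: F_def algebra_simps)
  also have "\<dots> = (\<integral>x. g (u t x) * p (u t x) \<partial>M) - lam t * (\<integral>x. g (u t x) \<partial>M)"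
    using integrable_comp[OF g_cont assms] 
      integrable_comp[OF continuous_on_mult[OF g_cont p_cont] assms]
    by (subst Bochner_Integration.integral_diff) auto
  also have "\<dots> = 0" using g_nonzero[OF assms] by (simp add: lam_def)
  finally show ?thesis .
qed

text \<open>\<open>lam\<close> is a quotient of two functionals that are differentiable in time,
  with nonvanishing denominator, hence continuous.\<close>

lemma lam_bounded_interval: "\<exists>L\<ge>0. \<forall>t\<in>{0..T}. \<bar>lam t\<bar> \<le> L"
proof (rule continuous_bounded_on_interval)
  have 1: "continuous_on {0..} (\<lambda>t. \<integral>x. g (u t x) \<partial>M)"
    using has_derivative_integral_comp_UNIV[OF g_deriv g'_cont]
    by (intro DERIV_continuous_on) auto
  have gp: "((\<lambda>s. g s * p s) has_real_derivative g' s * p s + p' s * g s) (at s)" for s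
    by (intro DERIV_mult g_deriv p_deriv)
  have gp': "continuous_on UNIV (\<lambda>s. g' s * p s + p' s * g s)"
    by (intro continuous_intros g'_cont p'_cont g_cont p_cont)
  have 2: "continuous_on {0..} (\<lambda>t. \<integral>x. g (u t x) * p (u t x) \<partial>M)"
    using has_derivative_integral_comp_UNIV[OF gp gp']
    by (intro DERIV_continuous_on) auto
  have "continuous_on {0..} lam"
    unfolding lam_def by (intro continuous_on_divide 1 2) (use g_nonzero in auto)
  then show "continuous_on {0..T} lam" by (rule continuous_on_subset) auto
qed

section \<open>Invariance of the lower bound 1 and of the value 1\<close>

text \<open>Since \<open>g\<close> vanishes at 1, the mean value inequality controls it by the
  distance to 1. This makes 1 a barrier for the flow.\<close>

lemma g_linear_bound: "\<exists>G\<ge>0. \<forall>s. \<bar>s\<bar> \<le> K \<longrightarrow> \<bar>g s\<bar> \<le> G * \<bar>s - 1\<bar>"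
proof -
  \<comment> \<open>The widening by 1 makes the interval contain the zero 1 of \<open>g\<close> for
    every \<open>K\<close>.\<close>
  let ?I = "{- (\<bar>K\<bar> + 1)..\<bar>K\<bar> + 1}"
  obtain G where G: "G \<ge> 0" "\<forall>s\<in>?I. \<bar>g' s\<bar> \<le> G"
    using continuous_bounded_on_interval[OF continuous_on_subset[OF g'_cont subset_UNIV]] by blast
  have "\<bar>g s\<bar> \<le> G * \<bar>s - 1\<bar>" if "\<bar>s\<bar> \<le> K" for s
  proof -
    have "norm (g s - g 1) \<le> G * norm (s - 1)"
      by (rule field_differentiable_bound[where S = ?I and f' = g'])
         (use G that in \<open>auto intro: has_field_derivative_at_within g_deriv\<close>)
    then show ?thesis by (simp add: g_one)
  qed
  with G(1) show ?thesis by blast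
qed

text \<open>On a bounded time interval \<open>F\<close> is at most a constant times
  \<open>\<bar>u - 1\<bar>\<close>, so \<open>ineq\<close> bounds the derivative of the integral of
  \<open>f (u t)\<close> over \<open>B\<close> by \<open>C\<close> times that integral, and
  Gronwall's inequality keeps it zero. The square of \<open>s - 1\<close> and the squared positive
  part of \<open>1 - s\<close> satisfy \<open>ineq\<close>.\<close>

lemma zero_preserved:
  assumes der: "\<And>s. (f has_real_derivative f' s) (at s)"
    and cont: "continuous_on UNIV f'" and nn: "\<And>s. 0 \<le> f s"
    and ineq: "\<And>s. \<bar>f' s\<bar> * \<bar>s - 1\<bar> \<le> 2 * f s"
    and B: "B \<in> sets M" and init: "AE x in M. x \<in> B \<longrightarrow> f (u 0 x) = 0" and t: "0 \<le> t"
  shows "AE x in M. x \<in> B \<longrightarrow> f (u t x) = 0"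
proof -
  let ?E = "\<lambda>t. \<integral>x. indicat_real B x * f (u t x) \<partial>M"
  have f_cont: "continuous_on UNIV f"
    by (rule DERIV_continuous_on[OF has_field_derivative_at_within[OF der]])
  obtain K where K: "\<forall>s\<in>{0..t}. AE x in M. \<bar>u s x\<bar> \<le> K" using u_bounded_interval[OF t] by blast
  obtain L where L: "L \<ge> 0" "\<forall>s\<in>{0..t}. \<bar>lam s\<bar> \<le> L" using lam_bounded_interval by blast
  obtain G where G: "G \<ge> 0" "\<forall>s. \<bar>s\<bar> \<le> K \<longrightarrow> \<bar>g s\<bar> \<le> G * \<bar>s - 1\<bar>" using g_linear_bound by blast
  obtain P where P: "P \<ge> 0" "\<forall>s\<in>{-K..K}. \<bar>p s\<bar> \<le> P"
    using continuous_bounded_on_interval[OF p_cont] by blast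
  define C where "C = 2 * (G * (P + L))"
  have "?E t \<le> exp (C * (t - 0)) * ?E 0"
  proof (rule exp_decay_of_derivative_le[OF has_derivative_integral_comp[OF der cont B]])
    fix s assume s: "0 \<le> s" "s \<le> t"
    have "(\<integral>x. indicat_real B x * (f' (u s x) * F s x) \<partial>M) \<le> (\<integral>x. C * (indicat_real B x * f (u s x)) \<partial>M)"
    proof (rule integral_mono_AE)
      show "integrable M (\<lambda>x. indicat_real B x * (f' (u s x) * F s x))"
        using integrable_indicator_comp[OF continuous_on_mult[OF cont F_fun_cont] s(1) B]
        unfolding F_alt by simp
      show "integrable M (\<lambda>x. C * (indicat_real B x * f (u s x)))"
        by (intro integrable_mult_right integrable_indicator_comp f_cont s B)
      show "AE x in M. indicat_real B x * (f' (u s x) * F s x) \<le> C * (indicat_real B x * f (u s x))"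
        using K[rule_format, of s]
      proof (rule AE_mp)
        show "s \<in> {0..t}" using s by simp
      next
        show "AE x in M. \<bar>u s x\<bar> \<le> K \<longrightarrow>
            indicat_real B x * (f' (u s x) * F s x) \<le> C * (indicat_real B x * f (u s x))"
        proof (rule AE_I2, rule impI)
          fix x assume x: "\<bar>u s x\<bar> \<le> K"
          have pl: "\<bar>p (u s x) - lam s\<bar> \<le> P + L"
          proof -
            have "\<bar>p (u s x)\<bar> \<le> P" using x by (intro P(2)[rule_format]) auto
            moreover have "\<bar>lam s\<bar> \<le> L" using L(2) s by auto
            ultimately show ?thesis by linarith
          qed
          have "\<bar>F s x\<bar> \<le> (G * \<bar>u s x - 1\<bar>) * (P + L)"
            unfolding F_def abs_mult using G x pl by (intro mult_mono) auto
          then have "\<bar>f' (u s x) * F s x\<bar> \<le> \<bar>f' (u s x)\<bar> * ((G * \<bar>u s x - 1\<bar>) * (P + L))"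
            unfolding abs_mult by (intro mult_left_mono) auto
          also have "\<dots> = (G * (P + L)) * (\<bar>f' (u s x)\<bar> * \<bar>u s x - 1\<bar>)" by (simp add: algebra_simps)
          also have "\<dots> \<le> (G * (P + L)) * (2 * f (u s x))"
            using G(1) P(1) L(1) by (intro mult_left_mono ineq) auto
          finally show "indicat_real B x * (f' (u s x) * F s x) \<le> C * (indicat_real B x * f (u s x))"
            by (auto simp: C_def indicator_def)
        qed
      qed
    qed
    then show "(\<integral>x. indicat_real B x * (f' (u s x) * F s x) \<partial>M) \<le> C * ?E s" by simp
  qed (use t in auto)
  moreover have "?E 0 = 0"
  proof -
    have "?E 0 = (\<integral>x. 0 \<partial>M)"
      using integrable_indicator_comp[OF f_cont order_refl B] init
      by (intro integral_cong_AE) (auto elim!: eventually_mono simp: indicator_def)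
    then show ?thesis by simp
  qed
  ultimately have "?E t \<le> 0" by simp
  moreover have "0 \<le> ?E t" using nn by (intro integral_nonneg_AE) auto
  ultimately have "?E t = 0" by linarith
  then have "AE x in M. indicat_real B x * f (u t x) = 0"
    using nn by (subst (asm) integral_nonneg_eq_0_iff_AE[OF integrable_indicator_comp[OF f_cont t B]]) auto
  then show ?thesis by eventually_elim (auto simp: indicator_def)
qed

lemma u_ge_1:
  assumes "0 \<le> t"
  shows "AE x in M. 1 \<le> u t x"
proof -
  have "AE x in M. x \<in> space M \<longrightarrow> (max 0 (1 - u t x))\<^sup>2 = 0"
  proof (rule zero_preserved[OF has_real_derivative_max_square_diff(1) _ _ _ sets.top _ assms])
    show "\<bar>- 2 * max 0 (1 - s)\<bar> * \<bar>s - 1\<bar> \<le> 2 * (max 0 (1 - s))\<^sup>2" for s :: real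
      by (auto simp: max_def power2_eq_square)
    show "AE x in M. x \<in> space M \<longrightarrow> (max 0 (1 - u 0 x))\<^sup>2 = 0"
      using u_init by eventually_elim auto
  qed (auto intro!: continuous_intros)
  then show ?thesis using AE_space by eventually_elim (auto simp: max_def split: if_splits)
qed

definition A where "A = {x \<in> space M. 1 < u 0 x}"

lemma A_sets [measurable]: "A \<in> sets M"
  unfolding A_def using u_meas[of 0] by measurable

lemma u_eq_1:
  assumes "0 \<le> t"
  shows "AE x in M. x \<notin> A \<longrightarrow> u t x = 1"
proof -
  have "AE x in M. x \<in> space M - A \<longrightarrow> (u t x - 1)\<^sup>2 = 0"
  proof (rule zero_preserved[where f' = "\<lambda>s. 2 * (s - 1)", OF _ _ _ _ _ _ assms])
    show "((\<lambda>s. (s - 1)\<^sup>2) has_real_derivative 2 * (s - 1)) (at s)" for s :: real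
      by (auto intro!: derivative_eq_intros)
    show "\<bar>2 * (s - 1)\<bar> * \<bar>s - 1\<bar> \<le> 2 * (s - 1)\<^sup>2" for s :: real
      unfolding abs_mult power2_eq_square mult.assoc abs_mult_self_eq by simp
    show "AE x in M. x \<in> space M - A \<longrightarrow> (u 0 x - 1)\<^sup>2 = 0"
      using u_init by eventually_elim (auto simp: A_def)
  qed (auto intro!: continuous_intros)
  then show ?thesis using AE_space by eventually_elim auto
qed

section \<open>The nonlocal term as a weighted mean\<close>

lemma g_nonpos: "1 \<le> s \<Longrightarrow> g s \<le> 0"
  using g_neg[of s] g_one by (cases "s = 1") auto

lemma integral_g_neg:
  assumes "0 \<le> t"
  shows "(\<integral>x. g (u t x) \<partial>M) < 0"
proof -
  have "(\<integral>x. g (u t x) \<partial>M) \<le> (\<integral>x. 0 \<partial>M)"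
    using u_ge_1[OF assms] by (intro integral_mono_AE integrable_comp g_cont assms)
      (auto elim!: eventually_mono intro: g_nonpos)
  then show ?thesis using g_nonzero[OF assms] by simp
qed

lemma lam_times_integral: "0 \<le> t \<Longrightarrow> lam t * (\<integral>x. g (u t x) \<partial>M) = (\<integral>x. g (u t x) * p (u t x) \<partial>M)"
  using g_nonzero by (simp add: lam_def)

text \<open>Integrating \<open>p 1 \<le> p (u t) \<le> p K\<close> against the nonpositive weight
  \<open>g (u t)\<close> and dividing by its negative integral gives
  \<open>p 1 \<le> lam t \<le> p K\<close>; the intermediate value theorem supplies
  \<open>s\<close>.\<close>

lemma lam_mean_value:
  assumes t: "0 \<le> t" and K: "1 \<le> K" "AE x in M. u t x \<le> K"
  shows "\<exists>s\<in>{1..K}. p s = lam t"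
proof -
  note intg = integrable_comp[OF g_cont t]
  note intgp = integrable_comp[OF continuous_on_mult[OF g_cont p_cont] t]
  have mono: "p a \<le> p b" if "a \<le> b" for a b
    using p_mono that by (simp add: strict_mono_less_eq)
  have "(\<integral>x. g (u t x) * p (u t x) \<partial>M) \<le> (\<integral>x. p 1 * g (u t x) \<partial>M)"
    using u_ge_1[OF t]
    by (intro integral_mono_AE intgp integrable_mult_right intg, eventually_elim)
       (auto simp: mult.commute[of "p 1"] intro!: mult_left_mono_neg g_nonpos mono)
  then have "p 1 \<le> lam t"
    using integral_g_neg[OF t] by (simp add: lam_times_integral[OF t, symmetric] mult_le_cancel_right)
  moreover have "(\<integral>x. p K * g (u t x) \<partial>M) \<le> (\<integral>x. g (u t x) * p (u t x) \<partial>M)"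
    using u_ge_1[OF t] K(2)
    by (intro integral_mono_AE intgp integrable_mult_right intg, eventually_elim)
       (auto simp: mult.commute[of "p K"] intro!: mult_left_mono_neg g_nonpos mono)
  then have "lam t \<le> p K"
    using integral_g_neg[OF t] by (simp add: lam_times_integral[OF t, symmetric] mult_le_cancel_right)
  ultimately show ?thesis using IVT'[of p 1 "lam t" K] K(1) p_cont by auto
qed

text \<open>
  Chebyshev's correlation inequality: under the probability weight proportional to \<open>- g (u t)\<close>
  the value \<open>lam t\<close> is the mean of \<open>p (u t)\<close>, and \<open>f' (u t)\<close> and \<open>p (u t)\<close> are similarly ordered.
\<close>
lemma integral_mono_F_nonpos:
  assumes cont: "continuous_on UNIV f'" and mono: "mono f'" and t: "0 \<le> t"
  shows "(\<integral>x. f' (u t x) * F t x \<partial>M) \<le> 0"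
proof -
  obtain K0 where "AE x in M. \<bar>u t x\<bar> \<le> K0" using u_bounded[OF t] by blast
  then have "AE x in M. u t x \<le> max 1 K0" by eventually_elim auto
  then obtain s where s: "p s = lam t" using lam_mean_value[OF t, of "max 1 K0"] by auto
  have intF: "integrable M (F t)" using integrable_comp[OF F_fun_cont t] unfolding F_alt by simp
  have int: "integrable M (\<lambda>x. f' (u t x) * F t x)"
    using integrable_comp[OF continuous_on_mult[OF cont F_fun_cont] t] unfolding F_alt by simp
  \<comment> \<open>\<open>F t\<close> has zero integral, so the constant \<open>f' s\<close> may be
    subtracted. The integrand becomes \<open>g (u t x)\<close> times a product of similarly ordered
    differences and is nonpositive pointwise.\<close>
  have "(\<integral>x. f' (u t x) * F t x \<partial>M) = (\<integral>x. f' (u t x) * F t x - f' s * F t x \<partial>M)"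
    using int intF integral_F[OF t] by simp
  also have "\<dots> \<le> (\<integral>x. 0 \<partial>M)"
  proof (rule integral_mono_AE)
    show "integrable M (\<lambda>x. f' (u t x) * F t x - f' s * F t x)" using int intF by simp
    show "AE x in M. f' (u t x) * F t x - f' s * F t x \<le> 0"
      using u_ge_1[OF t]
    proof eventually_elim
      case (elim x)
      have "0 \<le> (f' (u t x) - f' s) * (p (u t x) - p s)"
        using mono p_mono
        by (cases "s \<le> u t x") (auto simp: zero_le_mult_iff mono_def strict_mono_less_eq)
      then have "g (u t x) * ((f' (u t x) - f' s) * (p (u t x) - p s)) \<le> 0"
        using g_nonpos[OF elim] by (simp add: mult_le_0_iff)
      then show ?case by (simp add: F_def s algebra_simps)
    qed
  qed simp
  finally show ?thesis by simp
qed

section \<open>Monotone and conserved integrals\<close>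

lemma convex_integral_decreasing:
  assumes der: "\<And>s. (f has_real_derivative f' s) (at s)"
    and cont: "continuous_on UNIV f'" and mono: "mono f'" and t: "0 \<le> t"
  shows "(\<integral>x. f (u t x) \<partial>M) \<le> (\<integral>x. f (u 0 x) \<partial>M)"
  using exp_decay_of_derivative_le[OF has_derivative_integral_comp_UNIV[OF der cont], of 0 t 0]
    integral_mono_F_nonpos[OF cont mono] t
  by simp

text \<open>Both \<open>s\<close> and \<open>- s\<close> have a constant, hence monotone,
  derivative, so the integral can neither increase nor decrease.\<close>

lemma integral_u_constant:
  assumes "0 \<le> t"
  shows "(\<integral>x. u t x \<partial>M) = (\<integral>x. u 0 x \<partial>M)"
proof (rule antisym)
  show "(\<integral>x. u t x \<partial>M) \<le> (\<integral>x. u 0 x \<partial>M)"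
    by (rule convex_integral_decreasing[of "\<lambda>s. s" "\<lambda>_. 1", OF _ _ _ assms])
      (auto intro!: derivative_eq_intros monoI)
  have "(\<integral>x. - u t x \<partial>M) \<le> (\<integral>x. - u 0 x \<partial>M)"
    by (rule convex_integral_decreasing[of "\<lambda>s. - s" "\<lambda>_. - 1", OF _ _ _ assms])
      (auto intro!: derivative_eq_intros monoI)
  then show "(\<integral>x. u 0 x \<partial>M) \<le> (\<integral>x. u t x \<partial>M)" by simp
qed

text \<open>The convex penalty for exceeding an initial bound \<open>K\<close> has integral 0 at
  time 0, and this integral cannot increase.\<close>

lemma u_upper_bound: "\<exists>K\<ge>1. \<forall>t\<ge>0. AE x in M. u t x \<le> K"
proof -
  obtain K0 where K0: "AE x in M. \<bar>u 0 x\<bar> \<le> K0" using u_bounded[of 0] by blast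
  define K where "K = max 1 K0"
  let ?f = "\<lambda>s. (max 0 (s - K))\<^sup>2"
  have f_cont: "continuous_on UNIV ?f" by (intro continuous_intros)
  have "AE x in M. u t x \<le> K" if t: "0 \<le> t" for t
  proof -
    have "(\<integral>x. ?f (u t x) \<partial>M) \<le> (\<integral>x. ?f (u 0 x) \<partial>M)"
      by (rule convex_integral_decreasing[OF has_real_derivative_max_square_diff(2) _ _ t]) (auto intro!: continuous_intros monoI)
    also have "\<dots> = (\<integral>x. 0 \<partial>M)"
      using K0 measurable_comp[OF f_cont, of 0]
      by (intro integral_cong_AE) (auto elim!: eventually_mono simp: K_def max_def)
    finally have "(\<integral>x. ?f (u t x) \<partial>M) \<le> 0" by simp
    moreover have "0 \<le> (\<integral>x. ?f (u t x) \<partial>M)" by simp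
    ultimately have "(\<integral>x. ?f (u t x) \<partial>M) = 0" by linarith
    then have "AE x in M. ?f (u t x) = 0"
      by (subst (asm) integral_nonneg_eq_0_iff_AE[OF integrable_comp[OF f_cont t]]) auto
    then show ?thesis by eventually_elim (auto simp: max_def split: if_splits)
  qed
  moreover have "1 \<le> K" by (simp add: K_def)
  ultimately show ?thesis by blast
qed

section \<open>A lower bound for the nonlocal term\<close>

lemma p_le: "a \<le> b \<Longrightarrow> p a \<le> p b"
  using p_mono by (simp add: strict_mono_less_eq)

lemma integral_excess_pos: "0 < (\<integral>x. u 0 x - 1 \<partial>M)"
proof -
  have int: "integrable M (\<lambda>x. u 0 x - 1)"
    by (intro integrable_comp[of "\<lambda>s. s - 1"] continuous_intros order_refl)
  have nn: "AE x in M. 0 \<le> u 0 x - 1" using u_init by eventually_elim auto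
  have "(\<integral>x. u 0 x - 1 \<partial>M) \<noteq> 0"
    using u_init_nontrivial by (subst integral_nonneg_eq_0_iff_AE[OF int nn]) auto
  then show ?thesis using integral_nonneg_AE[OF nn] by linarith
qed

text \<open>The excess \<open>m\<close> of \<open>u\<close> over 1 is positive and conserved, so
  \<open>u\<close> cannot collapse onto 1. The interpolation inequality turns this into a lower
  bound for \<open>(lam t - p 1) * D\<close>, where \<open>D\<close>, minus the integral of
  \<open>g (u t)\<close>, is bounded above.\<close>

lemma lam_lower_bound: "\<exists>k>0. \<forall>t\<ge>0. p 1 + k \<le> lam t"
proof -
  define m where "m = (\<integral>x. u 0 x - 1 \<partial>M)"
  define N where "N = measure M (space M)"
  have m: "0 < m" using integral_excess_pos by (simp add: m_def)
  have N: "0 \<le> N" by (simp add: N_def)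
  obtain K where K: "K \<ge> 1" "\<And>t. 0 \<le> t \<Longrightarrow> AE x in M. u t x \<le> K" using u_upper_bound by blast
  obtain G where G: "G \<ge> 0" "\<And>s. s \<in> {1..K} \<Longrightarrow> \<bar>g s\<bar> \<le> G"
    using continuous_bounded_on_interval[OF g_cont] by blast
  \<comment> \<open>With this choice \<open>r * N \<le> m / 2\<close>: the error term absorbs at
    most half of the excess.\<close>
  define r where "r = m / (2 * (N + 1))"
  have r: "0 < r" using m N by (simp add: r_def)
  have "r * N \<le> r * (N + 1)" using r by (intro mult_left_mono) auto
  also have "\<dots> = m / 2" using N by (simp add: r_def field_simps)
  finally have rN: "r * N \<le> m / 2" .
  have "\<exists>C>0. \<forall>s\<in>{1..K}. s - 1 \<le> r + C * (g s * (p 1 - p s))"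
  proof (rule compact_interpolation_le[OF _ _ _ _ _ r])
    fix s assume s: "s \<in> {1..K}"
    then show "0 \<le> g s * (p 1 - p s)" by (intro mult_nonpos_nonpos) (auto intro: g_nonpos p_le)
    assume "g s * (p 1 - p s) = 0"
    then have "s = 1" using s g_neg[of s] strict_mono_eq[OF p_mono, of 1 s] by force
    then show "s - 1 \<le> 0" by simp
  qed (auto intro!: continuous_intros g_cont p_cont)
  then obtain C where C: "C > 0" "\<And>s. s \<in> {1..K} \<Longrightarrow> s - 1 \<le> r + C * (g s * (p 1 - p s))" by blast
  have "p 1 + m / (2 * C * (G * N + 1)) \<le> lam t" if t: "0 \<le> t" for t
  proof -
    note range = u_ge_1[OF t] K(2)[OF t]
    define D where "D = - (\<integral>x. g (u t x) \<partial>M)"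
    have D: "0 < D" using integral_g_neg[OF t] by (simp add: D_def)
    have "\<bar>\<integral>x. g (u t x) \<partial>M\<bar> \<le> G * N" unfolding N_def
      using range by (intro abs_integral_le_AE_bound integrable_comp g_cont t, eventually_elim) (auto intro: G)
    then have DG: "D \<le> G * N + 1" by (simp add: D_def)
    have int: "integrable M (\<lambda>x. g (u t x) * (p 1 - p (u t x)))"
      by (intro integrable_comp[of "\<lambda>s. g s * (p 1 - p s)"] continuous_intros g_cont p_cont t)
    have "m = (\<integral>x. u t x - 1 \<partial>M)"
      using integral_u_constant[OF t] integrable_comp[OF continuous_on_id t]
        integrable_comp[OF continuous_on_id order_refl] by (simp add: m_def)
    also have "\<dots> \<le> (\<integral>x. r + C * (g (u t x) * (p 1 - p (u t x))) \<partial>M)"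
      using range
      by (intro integral_mono_AE integrable_comp[of "\<lambda>s. s - 1"] continuous_intros t
          Bochner_Integration.integrable_add integrable_mult_right int, simp, eventually_elim)
         (auto intro: C(2))
    also have "\<dots> = r * N + C * (\<integral>x. g (u t x) * (p 1 - p (u t x)) \<partial>M)"
      using int by (simp add: N_def)
    also have "(\<integral>x. g (u t x) * (p 1 - p (u t x)) \<partial>M)
        = (\<integral>x. p 1 * g (u t x) - g (u t x) * p (u t x) \<partial>M)" by (simp add: algebra_simps)
    also have "\<dots> = p 1 * (\<integral>x. g (u t x) \<partial>M) - (\<integral>x. g (u t x) * p (u t x) \<partial>M)"
      using integrable_comp[OF g_cont t]
        integrable_comp[OF continuous_on_mult[OF g_cont p_cont] t] by simp
    also have "\<dots> = (lam t - p 1) * D"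
      by (simp add: lam_times_integral[OF t, symmetric] D_def algebra_simps)
    finally have "m / 2 \<le> C * ((lam t - p 1) * D)" using rN by simp
    then have *: "m / (2 * C) \<le> (lam t - p 1) * D" using C(1) by (simp add: field_simps)
    moreover have "0 < m / (2 * C)" using m C(1) by simp
    ultimately have "0 < (lam t - p 1) * D" by linarith
    then have "0 < lam t - p 1" using D by (simp add: zero_less_mult_iff)
    then have "(lam t - p 1) * D \<le> (lam t - p 1) * (G * N + 1)" using DG by (intro mult_left_mono) auto
    with * have "m / (2 * C) \<le> (lam t - p 1) * (G * N + 1)" by linarith
    moreover have "0 < G * N + 1" using G(1) N by (simp add: add_nonneg_pos)
    ultimately have "m / (2 * C) / (G * N + 1) \<le> lam t - p 1" by (simp only: pos_divide_le_eq)
    then show ?thesis by simp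
  qed
  moreover have "0 < m / (2 * C * (G * N + 1))"
    using m C(1) G(1) N by (intro divide_pos_pos mult_pos_pos) (auto intro: add_nonneg_pos)
  ultimately show ?thesis by blast
qed

section \<open>Escape from the neighbourhood of 1\<close>

text \<open>Continuity of \<open>p\<close> at 1 costs at most half of the gap between
  \<open>lam t\<close> and \<open>p 1\<close>; monotonicity of \<open>p\<close> extends the bound to
  all smaller arguments.\<close>

lemma speed_near_one:
  "\<exists>k>0. \<exists>d>0. \<forall>t\<ge>0. \<forall>s\<le>1 + d. k \<le> lam t - p s"
proof -
  obtain k where k: "k > 0" "\<And>t. 0 \<le> t \<Longrightarrow> p 1 + k \<le> lam t" using lam_lower_bound by blast
  have "isCont p 1" using p_deriv DERIV_isCont by blast
  then obtain d where d: "d > 0" "\<And>s. \<bar>s - 1\<bar> < d \<Longrightarrow> \<bar>p s - p 1\<bar> < k / 2"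
    unfolding continuous_at_eps_delta dist_real_def using k(1) by (meson half_gt_zero)
  have "k / 2 \<le> lam t - p s" if "0 \<le> t" "s \<le> 1 + d / 2" for t s
    proof -
    have "\<bar>p (1 + d / 2) - p 1\<bar> < k / 2" by (rule d(2)) (use d(1) in simp)
    then have "p (1 + d / 2) - p 1 < k / 2" by (rule le_less_trans[OF abs_ge_self])
    then show ?thesis using k(2)[OF that(1)] p_le[OF that(2)] by linarith
  qed
  then show ?thesis using k(1) d(1) by (intro exI[of _ "k / 2"] conjI exI[of _ "d / 2"]) auto
qed

context
  fixes k d :: real
  assumes k: "0 < k" and d: "0 < d" and speed: "\<And>t s. 0 \<le> t \<Longrightarrow> s \<le> 1 + d \<Longrightarrow> k \<le> lam t - p s"
begin

lemma F_lower: "0 \<le> t \<Longrightarrow> 1 \<le> u t x \<Longrightarrow> u t x \<le> 1 + d \<Longrightarrow> k * (- g (u t x)) \<le> F t x"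
  using mult_right_mono[OF speed[of t "u t x"], of "- g (u t x)"] g_nonpos[of "u t x"]
  by (simp add: F_def algebra_simps)

lemma integrable_dissipation:
  assumes "B \<in> sets M" "0 \<le> t"
  shows "integrable M (\<lambda>x. indicat_real B x * (- 2 * max 0 (a - u t x) * F t x))"
proof -
  have "continuous_on UNIV (\<lambda>s. - 2 * max 0 (a - s) * (g s * (p s - lam t)))"
    by (intro continuous_intros g_cont p_cont)
  from integrable_indicator_comp[OF this assms(2,1)] show ?thesis by (simp add: F_def)
qed

text \<open>As \<open>e \<le> d\<close>, the drift \<open>F\<close> is nonnegative where
  \<open>1 \<le> u \<le> 1 + e\<close>. The penalty for falling below \<open>1 + e\<close>,
  integrated over the points that start at or above it, cannot grow from its initial value
  0.\<close>

lemma superlevel_invariant: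
  assumes e: "e \<le> d" and t: "0 \<le> t"
  shows "AE x in M. 1 + e \<le> u 0 x \<longrightarrow> 1 + e \<le> u t x"
proof -
  let ?B = "{x \<in> space M. 1 + e \<le> u 0 x}"
  let ?f = "\<lambda>s. (max 0 (1 + e - s))\<^sup>2"
  let ?E = "\<lambda>t. \<integral>x. indicat_real ?B x * ?f (u t x) \<partial>M"
  have B: "?B \<in> sets M" using u_meas[of 0] by measurable
  have f_cont: "continuous_on UNIV ?f" by (intro continuous_intros)
  have cont: "continuous_on UNIV (\<lambda>s. - 2 * max 0 (1 + e - s))" by (intro continuous_intros)
  have "?E t \<le> exp (0 * (t - 0)) * ?E 0"
  proof (rule exp_decay_of_derivative_le[OF
        has_derivative_integral_comp[OF has_real_derivative_max_square_diff(1) cont B] _ order_refl t])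
    fix s :: real assume s: "0 \<le> s"
    have "(\<integral>x. indicat_real ?B x * (- 2 * max 0 (1 + e - u s x) * F s x) \<partial>M) \<le> (\<integral>x. 0 \<partial>M)"
    proof (rule integral_mono_AE[OF integrable_dissipation[OF B s]])
      show "AE x in M. indicat_real ?B x * (- 2 * max 0 (1 + e - u s x) * F s x) \<le> 0"
        using u_ge_1[OF s]
      proof eventually_elim
        case (elim x)
        have "0 \<le> max 0 (1 + e - u s x) * F s x"
        proof (cases "u s x \<le> 1 + e")
          case True
          then have "k * (- g (u s x)) \<le> F s x" using e elim s by (intro F_lower) auto
          moreover have "0 \<le> k * (- g (u s x))" using k g_nonpos[OF elim] by (simp add: mult_le_0_iff)
          ultimately show ?thesis by simp
        qed simp
        then show ?case by (simp add: indicator_def mult.commute)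
      qed
    qed simp
    then show "(\<integral>x. indicat_real ?B x * (- 2 * max 0 (1 + e - u s x) * F s x) \<partial>M) \<le> 0 * ?E s" by simp
  qed
  also have "?E 0 = (\<integral>x. 0 \<partial>M)"
    by (intro Bochner_Integration.integral_cong refl) (auto simp: indicator_def)
  finally have "?E t \<le> 0" by simp
  moreover have "0 \<le> ?E t" by simp
  ultimately have "?E t = 0" by linarith
  then have "AE x in M. indicat_real ?B x * ?f (u t x) = 0"
    by (subst (asm) integral_nonneg_eq_0_iff_AE[OF integrable_indicator_comp[OF f_cont t B]]) auto
  then show ?thesis using AE_space
    by eventually_elim (auto simp: indicator_def max_def split: if_splits)
qed

text \<open>Points that start at or above \<open>1 + e\<close> stay there. On the compact range from
  \<open>1 + e\<close> to \<open>1 + d\<close> the factor \<open>- g\<close> has a positive minimum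
  \<open>- g y\<close>, so the deficit shrinks at speed at least \<open>k * (- g y)\<close>.\<close>

lemma deficit_exp_decay:
  assumes e: "0 < e" "e \<le> d"
  shows "\<exists>c>0. \<forall>t\<ge>0. (\<integral>x. indicat_real {x \<in> space M. 1 + e \<le> u 0 x} x * (max 0 (1 + d - u t x))\<^sup>2 \<partial>M)
    \<le> exp (- c * t) * (\<integral>x. indicat_real {x \<in> space M. 1 + e \<le> u 0 x} x * (max 0 (1 + d - u 0 x))\<^sup>2 \<partial>M)"
proof -
  let ?B = "{x \<in> space M. 1 + e \<le> u 0 x}"
  let ?f = "\<lambda>s. (max 0 (1 + d - s))\<^sup>2"
  let ?E = "\<lambda>t. \<integral>x. indicat_real ?B x * ?f (u t x) \<partial>M"
  have B: "?B \<in> sets M" using u_meas[of 0] by measurable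
  have f_cont: "continuous_on UNIV ?f" by (intro continuous_intros)
  have cont: "continuous_on UNIV (\<lambda>s. - 2 * max 0 (1 + d - s))" by (intro continuous_intros)
  have "\<exists>y\<in>{1 + e..1 + d}. \<forall>s\<in>{1 + e..1 + d}. - g y \<le> - g s"
    by (rule continuous_attains_inf) (use e in \<open>auto intro!: continuous_intros g_cont\<close>)
  then obtain y where y: "y \<in> {1 + e..1 + d}" "\<And>s. s \<in> {1 + e..1 + d} \<Longrightarrow> - g y \<le> - g s" by blast
  \<comment> \<open>The squared deficit \<open>h\<^sup>2\<close> decreases at rate at least
    \<open>2 * h * (k * (- g y))\<close>; since \<open>h \<le> d\<close>, this is at least
    \<open>c * h\<^sup>2\<close>.\<close>
  define c where "c = 2 * k * (- g y) / d"
  have gy: "0 < - g y" using y(1) e g_neg[of y] by auto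
  have "?E t \<le> exp (- c * (t - 0)) * ?E 0" if t: "0 \<le> t" for t
  proof (rule exp_decay_of_derivative_le[OF
        has_derivative_integral_comp[OF has_real_derivative_max_square_diff(1) cont B] _ order_refl t])
    fix s :: real assume s: "0 \<le> s"
    have "(\<integral>x. indicat_real ?B x * (- 2 * max 0 (1 + d - u s x) * F s x) \<partial>M)
        \<le> (\<integral>x. - c * (indicat_real ?B x * ?f (u s x)) \<partial>M)"
    proof (rule integral_mono_AE[OF integrable_dissipation[OF B s]])
      show "AE x in M. indicat_real ?B x * (- 2 * max 0 (1 + d - u s x) * F s x)
          \<le> - c * (indicat_real ?B x * ?f (u s x))"
        using u_ge_1[OF s] superlevel_invariant[OF e(2) s]
      proof eventually_elim
        case (elim x)
        show ?case
        proof (cases "1 + e \<le> u 0 x \<and> u s x \<le> 1 + d")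
          case True
          define h where "h = 1 + d - u s x"
          have h: "0 \<le> h" "h \<le> d" using True elim by (auto simp: h_def)
          have "k * (- g y) \<le> k * (- g (u s x))" using k True elim by (intro mult_left_mono y(2)) auto
          also have "\<dots> \<le> F s x" using True elim s by (intro F_lower) auto
          finally have "2 * h * (k * (- g y)) \<le> 2 * h * F s x" using h by (intro mult_left_mono) auto
          moreover have "c * h\<^sup>2 = (2 * h * (k * (- g y))) * (h / d)"
            by (simp add: c_def power2_eq_square)
          moreover have "(2 * h * (k * (- g y))) * (h / d) \<le> (2 * h * (k * (- g y))) * 1"
            using h d k gy by (intro mult_left_mono mult_nonneg_nonneg) auto
          ultimately have "c * h\<^sup>2 \<le> 2 * h * F s x" by linarith
          moreover have "max 0 (1 + d - u s x) = h" using h(1) by (simp add: h_def)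
          ultimately show ?thesis by (simp add: indicator_def)
        qed (auto simp: indicator_def max_def)
      qed
      show "integrable M (\<lambda>x. - c * (indicat_real ?B x * ?f (u s x)))"
        by (intro integrable_mult_right integrable_indicator_comp f_cont s B)
    qed
    then show "(\<integral>x. indicat_real ?B x * (- 2 * max 0 (1 + d - u s x) * F s x) \<partial>M) \<le> - c * ?E s" by simp
  qed
  moreover have "0 < c" unfolding c_def using k d gy by (intro divide_pos_pos mult_pos_pos) auto
  ultimately show ?thesis by auto
qed

text \<open>The decay rate degenerates as the starting level approaches 1, so \<open>A\<close> is
  exhausted by the sets where \<open>1 + d / Suc n \<le> u 0 x\<close>. On one such set the deficit
  decays; the rest of \<open>A\<close> has small measure, and the squared deficit there is at most
  \<open>d\<^sup>2\<close>.\<close>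

lemma deficit_tendsto_0:
  "((\<lambda>t. \<integral>x. indicat_real A x * (max 0 (1 + d - u t x))\<^sup>2 \<partial>M) \<longlongrightarrow> 0) at_top"
proof (rule order_tendstoI)
  let ?f = "\<lambda>s. (max 0 (1 + d - s))\<^sup>2"
  let ?E = "\<lambda>B t. \<integral>x. indicat_real B x * ?f (u t x) \<partial>M"
  have f_cont: "continuous_on UNIV ?f" by (intro continuous_intros)
  show "\<forall>\<^sub>F t in at_top. a < ?E A t" if "a < 0" for a
    using that by (intro always_eventually allI, rule less_le_trans[OF _ integral_nonneg_AE]) auto
  fix r :: real assume r: "0 < r"
  let ?A = "\<lambda>n. A - {x \<in> space M. 1 + d / Suc n \<le> u 0 x}"
  have A_n: "?A n \<in> sets M" for n using u_meas[of 0] by measurable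
  have int_A: "integrable M (indicat_real (?A n))" for n
    using A_n[of n] by (intro integrable_real_indicator) (auto simp: emeasure_eq_measure)
  have "(\<lambda>n. measure M (?A n)) \<longlonglongrightarrow> measure M (\<Inter>n. ?A n)"
  proof (rule finite_Lim_measure_decseq)
    have "d / Suc n \<le> d / Suc m" if "m \<le> n" for m n
      using that d by (intro divide_left_mono) auto
    then show "decseq ?A" unfolding decseq_def by (auto intro: order_trans[OF add_left_mono])
  qed (use A_n in blast)
  moreover have "(\<Inter>n. ?A n) = {}"
  proof -
    have "\<exists>n. 1 + d / Suc n \<le> u 0 x" if "x \<in> A" for x
    proof -
      have "0 < (u 0 x - 1) / d" using that d by (simp add: A_def)
      then obtain n where "inverse (real (Suc n)) < (u 0 x - 1) / d" using reals_Archimedean by blast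
      then show ?thesis using d by (intro exI[of _ n]) (simp add: field_simps)
    qed
    then show ?thesis by (auto simp: A_def)
  qed
  ultimately have "(\<lambda>n. measure M (?A n)) \<longlonglongrightarrow> 0" by (simp only: measure_empty)
  then have "(\<lambda>n. d\<^sup>2 * measure M (?A n)) \<longlonglongrightarrow> d\<^sup>2 * 0"
    by (intro tendsto_mult_left)
  then have "\<forall>\<^sub>F n in sequentially. d\<^sup>2 * measure M (?A n) < r / 2"
    using r by (intro order_tendstoD(2)) auto
  then obtain n where n: "d\<^sup>2 * measure M (?A n) < r / 2"
    by (auto simp: eventually_sequentially)
  let ?B = "{x \<in> space M. 1 + d / Suc n \<le> u 0 x}"
  have B: "?B \<in> sets M" using u_meas[of 0] by measurable
  have "0 < d / Suc n" "d / Suc n \<le> d" using d by (auto simp: field_simps)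
  from deficit_exp_decay[OF this] obtain c where
    c: "c > 0" "\<And>t. 0 \<le> t \<Longrightarrow> ?E ?B t \<le> exp (- c * t) * ?E ?B 0" by blast
  have "((\<lambda>t. exp (- c * t) * ?E ?B 0) \<longlongrightarrow> 0) at_top"
    using c(1) by (rule exp_decay_tendsto_0)
  then have "\<forall>\<^sub>F t in at_top. exp (- c * t) * ?E ?B 0 < r / 2"
    using r by (intro order_tendstoD(2)) auto
  then show "\<forall>\<^sub>F t in at_top. ?E A t < r"
    using eventually_ge_at_top[of 0]
  proof eventually_elim
    case (elim t)
    have "?E A t \<le> (\<integral>x. indicat_real ?B x * ?f (u t x) + d\<^sup>2 * indicat_real (?A n) x \<partial>M)"
    proof (rule integral_mono_AE)
      show "AE x in M. indicat_real A x * ?f (u t x)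
          \<le> indicat_real ?B x * ?f (u t x) + d\<^sup>2 * indicat_real (?A n) x"
        using u_ge_1[OF elim(2)]
      proof eventually_elim
        case (elim x)
        then have "?f (u t x) \<le> d\<^sup>2" using d by (intro power_mono) auto
        then show ?case by (auto simp: indicator_def A_def)
      qed
      show "integrable M (\<lambda>x. indicat_real A x * ?f (u t x))"
        by (intro integrable_indicator_comp f_cont elim A_sets)
      show "integrable M (\<lambda>x. indicat_real ?B x * ?f (u t x) + d\<^sup>2 * indicat_real (?A n) x)"
        by (intro Bochner_Integration.integrable_add integrable_mult_right
            integrable_indicator_comp f_cont elim B int_A)
    qed
    also have "\<dots> = ?E ?B t + d\<^sup>2 * measure M (?A n)"
      using integrable_indicator_comp[OF f_cont elim(2) B]
      using int_A A_n[of n] by (subst Bochner_Integration.integral_add) (auto simp del: of_nat_Suc)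
    finally show ?case using n c(2)[OF elim(2)] elim(1) by linarith
  qed
qed

end

section \<open>Convergence to the mean on the set where the initial value exceeds 1\<close>

lemma measure_A_pos: "0 < measure M A"
proof -
  have "AE x in M. u 0 x = 1" if "measure M A = 0"
  proof -
    have "A \<in> null_sets M" using that by (simp add: null_sets_def emeasure_eq_measure)
    from AE_not_in[OF this] u_init AE_space show ?thesis
      by eventually_elim (auto simp: A_def)
  qed
  then show ?thesis using u_init_nontrivial measure_nonneg[of M A] by linarith
qed

text \<open>Since \<open>u t\<close> stays 1 off \<open>A\<close> and its integral is conserved,
  this is the mean of \<open>u t\<close> over \<open>A\<close> at every time.\<close>

definition mu where "mu = 1 + (\<integral>x. u 0 x - 1 \<partial>M) / measure M A"

lemma mu_gt_1: "1 < mu"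
  using integral_excess_pos measure_A_pos by (simp add: mu_def)

lemma integrable_A: "integrable M (indicat_real A)"
  by (intro integrable_real_indicator A_sets) (simp add: emeasure_eq_measure)

lemma integral_A_deviation:
  assumes t: "0 \<le> t"
  shows "(\<integral>x. indicat_real A x * (u t x - mu) \<partial>M) = 0"
proof -
  have int: "integrable M (\<lambda>x. indicat_real A x * (u t x - 1))"
    by (intro integrable_indicator_comp[of "\<lambda>s. s - 1"] continuous_intros t A_sets)
  have int1: "integrable M (\<lambda>x. u s x - 1)" if "0 \<le> s" for s
    by (intro integrable_comp[of "\<lambda>s. s - 1"] continuous_intros that)
  have "(\<integral>x. indicat_real A x * (u t x - mu) \<partial>M)
      = (\<integral>x. indicat_real A x * (u t x - 1) - (mu - 1) * indicat_real A x \<partial>M)"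
    by (simp add: algebra_simps)
  also have "\<dots> = (\<integral>x. indicat_real A x * (u t x - 1) \<partial>M) - (mu - 1) * measure M A"
    using int integrable_A by simp
  also have "(\<integral>x. indicat_real A x * (u t x - 1) \<partial>M) = (\<integral>x. u t x - 1 \<partial>M)"
    using u_eq_1[OF t] int int1[OF t]
    by (intro integral_cong_AE) (auto elim!: eventually_mono simp: indicator_def)
  also have "\<dots> = (\<integral>x. u 0 x - 1 \<partial>M)"
    using integral_u_constant[OF t] integrable_comp[OF continuous_on_id t]
      integrable_comp[OF continuous_on_id order_refl] by simp
  finally show ?thesis using measure_A_pos by (simp add: mu_def)
qed

text \<open>For each \<open>r\<close> the interpolation inequality, with \<open>s\<close> taken from
  \<open>p s = lam t\<close>, eventually bounds the derivative of \<open>?H\<close> by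
  \<open>- (2 / C) * (?H t - r / 2)\<close>, so \<open>?H\<close> drops below \<open>r\<close>. The
  constant \<open>C\<close> depends on \<open>r\<close>, hence the argument is run for each
  \<open>r\<close> separately.\<close>

lemma deviation_tendsto_0: "((\<lambda>t. \<integral>x. indicat_real A x * (u t x - mu)\<^sup>2 \<partial>M) \<longlongrightarrow> 0) at_top"
proof (rule order_tendstoI)
  let ?H = "\<lambda>t. \<integral>x. indicat_real A x * (u t x - mu)\<^sup>2 \<partial>M"
  let ?D = "\<lambda>t. \<integral>x. indicat_real A x * ((2 * (u t x - mu)) * F t x) \<partial>M"
  show "\<forall>\<^sub>F t in at_top. a < ?H t" if "a < 0" for a
    using that by (intro always_eventually allI, rule less_le_trans[OF _ integral_nonneg_AE]) auto
  fix r :: real assume r: "0 < r"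
  obtain K where K: "K \<ge> 1" "\<And>t. 0 \<le> t \<Longrightarrow> AE x in M. u t x \<le> K" using u_upper_bound by blast
  obtain k d where kd: "0 < k" "0 < d" "\<And>t s. 0 \<le> t \<Longrightarrow> s \<le> 1 + d \<Longrightarrow> k \<le> lam t - p s"
    using speed_near_one by blast
  let ?e = "\<lambda>t. \<integral>x. indicat_real A x * (max 0 (1 + d - u t x))\<^sup>2 \<partial>M"
  \<comment> \<open>The error term \<open>q\<close> contributes \<open>r / 4\<close> after
    integration over \<open>A\<close>.\<close>
  define q where "q = r / (4 * measure M A)"
  have q: "0 < q" "q * measure M A = r / 4" using r measure_A_pos by (auto simp: q_def)
  \<comment> \<open>\<open>?b\<close> vanishes only on the diagonal: its first summand is also zero
    at \<open>fst z = 1\<close>, where \<open>g\<close> vanishes, but there the squared deficit is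
    positive.\<close>
  let ?b = "\<lambda>z. (fst z - snd z) * (p (fst z) - p (snd z)) * (- g (fst z)) + (max 0 (1 + d - fst z))\<^sup>2"
  have pos: "0 \<le> (x - y) * (p x - p y)" for x y
    by (cases "x \<le> y") (auto simp: zero_le_mult_iff p_le)
  have "\<exists>C>0. \<forall>z\<in>{1..K} \<times> {1..K}. (fst z - snd z)\<^sup>2 \<le> q + C * ?b z"
  proof (rule compact_interpolation_le[OF _ _ _ _ _ q(1)])
    have p': "continuous_on S (\<lambda>z. p (fst z))" "continuous_on S (\<lambda>z. p (snd z))"
      "continuous_on S (\<lambda>z. g (fst z))" for S :: "(real \<times> real) set"
      by (rule continuous_on_compose2[OF p_cont[of UNIV]] continuous_on_compose2[OF g_cont[of UNIV]],
          auto intro: continuous_intros)+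
    show "continuous_on ({1..K} \<times> {1..K}) ?b"
      by (intro continuous_intros p')
    show "continuous_on ({1..K} \<times> {1..K}) (\<lambda>z. (fst z - snd z)\<^sup>2)"
      by (intro continuous_intros)
    show "compact ({1..K} \<times> {1..K})" by (intro compact_Times) auto
    fix z assume z: "z \<in> {1..K} \<times> {1..K}"
    have 1: "0 \<le> (fst z - snd z) * (p (fst z) - p (snd z)) * (- g (fst z))"
      using g_nonpos[of "fst z"] z by (intro mult_nonneg_nonneg[OF pos]) auto
    then show "0 \<le> ?b z" by (intro add_nonneg_nonneg) auto
    assume "?b z = 0"
    then have "(fst z - snd z) * (p (fst z) - p (snd z)) * (- g (fst z)) = 0"
      and "(max 0 (1 + d - fst z))\<^sup>2 = 0"
      using 1 zero_le_power2[of "max 0 (1 + d - fst z)"] by linarith+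
    moreover from this(2) have "1 < fst z" using kd(2) by (auto simp: max_def split: if_splits)
    ultimately have "fst z = snd z" using g_neg[of "fst z"] strict_mono_eq[OF p_mono] by auto
    then show "(fst z - snd z)\<^sup>2 \<le> 0" by simp
  qed
  then obtain C where C: "C > 0" "\<And>z. z \<in> {1..K} \<times> {1..K} \<Longrightarrow> (fst z - snd z)\<^sup>2 \<le> q + C * ?b z" by blast
  have ineq: "?H t \<le> r / 4 + C * (- ?D t / 2 + ?e t)" if t: "0 \<le> t" for t
  proof -
    obtain s where s: "s \<in> {1..K}" "p s = lam t" using lam_mean_value[OF t K(1) K(2)[OF t]] by blast
    have intc: "integrable M (\<lambda>x. indicat_real A x * f (u t x))" if "continuous_on UNIV f" for f :: "real \<Rightarrow> real"
      by (intro integrable_indicator_comp that t A_sets)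
    have intF: "integrable M (\<lambda>x. indicat_real A x * F t x)"
      using intc[OF F_fun_cont] unfolding F_alt .
    have intH: "integrable M (\<lambda>x. indicat_real A x * (u t x - mu)\<^sup>2)"
      by (intro intc[of "\<lambda>y. (y - mu)\<^sup>2"] continuous_intros)
    have intL: "integrable M (\<lambda>x. indicat_real A x * (u t x - mu))"
      by (intro intc[of "\<lambda>y. y - mu"] continuous_intros)
    have intD: "integrable M (\<lambda>x. indicat_real A x * ((2 * (u t x - mu)) * F t x))"
      unfolding F_alt
      by (intro intc[of "\<lambda>y. (2 * (y - mu)) * (g y * (p y - lam t))"] continuous_intros g_cont p_cont)
    have intE: "integrable M (\<lambda>x. indicat_real A x * (max 0 (1 + d - u t x))\<^sup>2)"
      by (intro intc[of "\<lambda>y. (max 0 (1 + d - y))\<^sup>2"] continuous_intros)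
    have F0: "(\<integral>x. indicat_real A x * F t x \<partial>M) = 0"
    proof -
      have "(\<integral>x. indicat_real A x * F t x \<partial>M) = (\<integral>x. F t x \<partial>M)"
        using u_eq_1[OF t] intF integrable_comp[OF F_fun_cont t]
        by (intro integral_cong_AE) (auto elim!: eventually_mono simp: indicator_def F_def g_one)
      then show ?thesis using integral_F[OF t] by simp
    qed
    \<comment> \<open>The value \<open>s\<close> varies with \<open>t\<close> but drops out:
      \<open>(s - mu) * F t x\<close> and \<open>2 * (s - mu) * (u t x - mu)\<close> have zero
      integral over \<open>A\<close>. What remains is \<open>?D\<close>, the derivative of
      \<open>?H\<close>, together with the deficit.\<close>
    have "?H t \<le> (\<integral>x. (q * indicat_real A x + C * (- (1/2) * (indicat_real A x * ((2 * (u t x - mu)) * F t x))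
        + (s - mu) * (indicat_real A x * F t x) + indicat_real A x * (max 0 (1 + d - u t x))\<^sup>2))
        + 2 * (s - mu) * (indicat_real A x * (u t x - mu)) \<partial>M)"
    proof (rule integral_mono_AE[OF intH])
      show "AE x in M. indicat_real A x * (u t x - mu)\<^sup>2 \<le>
          (q * indicat_real A x + C * (- (1/2) * (indicat_real A x * ((2 * (u t x - mu)) * F t x))
          + (s - mu) * (indicat_real A x * F t x) + indicat_real A x * (max 0 (1 + d - u t x))\<^sup>2))
          + 2 * (s - mu) * (indicat_real A x * (u t x - mu))"
        using u_ge_1[OF t] K(2)[OF t]
      proof eventually_elim
        case (elim x)
        have "(u t x - s)\<^sup>2 \<le> q + C * ((u t x - s) * (p (u t x) - p s) * (- g (u t x))
            + (max 0 (1 + d - u t x))\<^sup>2)"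
          using C(2)[of "(u t x, s)"] elim s by simp
        also have "(u t x - s) * (p (u t x) - p s) * (- g (u t x))
            = - (1/2) * ((2 * (u t x - mu)) * F t x) + (s - mu) * F t x"
          by (simp add: F_def s(2) algebra_simps)
        finally have "(u t x - s)\<^sup>2 \<le> q + C * (- (1/2) * ((2 * (u t x - mu)) * F t x) + (s - mu) * F t x
            + (max 0 (1 + d - u t x))\<^sup>2)" .
        moreover have "(u t x - mu)\<^sup>2 \<le> (u t x - s)\<^sup>2 + 2 * (s - mu) * (u t x - mu)"
        proof -
          have "(u t x - s)\<^sup>2 + 2 * (s - mu) * (u t x - mu) = (u t x - mu)\<^sup>2 + (s - mu)\<^sup>2"
            by (simp add: power2_eq_square algebra_simps)
          then show ?thesis by simp
        qed
        ultimately show ?case by (cases "x \<in> A") auto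
      qed
    qed (intro Bochner_Integration.integrable_add integrable_mult_right integrable_A intD intF intE intL)
    also have "\<dots> = q * measure M A + C * (- (1/2) * ?D t + (s - mu) * 0 + ?e t) + 2 * (s - mu) * 0"
      using integrable_A intD intF intE intL
      by (simp only: Bochner_Integration.integral_add Bochner_Integration.integrable_add
          integrable_mult_right integral_mult_right_zero F0 integral_A_deviation[OF t])
        (simp add: A_sets sets.Int_space_eq2)
    finally show ?thesis using q by simp
  qed
  \<comment> \<open>This threshold makes \<open>C * ?e t\<close> at most \<open>r / 4\<close>; with
    the \<open>r / 4\<close> from \<open>q\<close> it gives the level \<open>r / 2\<close> towards
    which \<open>?H\<close> is driven.\<close>
  have "\<forall>\<^sub>F t in at_top. ?e t < r / (4 * C)"
    using order_tendstoD(2)[OF deficit_tendsto_0[OF kd], of "r / (4 * C)"] r C(1) by simp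
  then obtain S0 where S0: "\<And>t. S0 \<le> t \<Longrightarrow> ?e t < r / (4 * C)" by (auto simp: eventually_at_top_linorder)
  define S where "S = max 0 S0"
  have D: "?D t \<le> - (2 / C) * (?H t - r / 2)" if t: "S \<le> t" for t
  proof -
    have "C * ?e t \<le> r / 4" using S0[of t] t C(1) by (simp add: S_def field_simps)
    moreover have "D \<le> - (2 / C) * (h - r / 2)"
      if "h \<le> r / 4 + C * (- D / 2 + e)" "C * e \<le> r / 4" for h D e
    proof -
      have "C * D \<le> - 2 * (h - r / 2)" using that by (simp add: algebra_simps)
      then show ?thesis using C(1) by (simp add: field_simps)
    qed
    ultimately show ?thesis using ineq[of t] t by (simp only: S_def) auto
  qed
  have der: "((\<lambda>t. ?H t - r / 2) has_real_derivative ?D t) (at t within {0..})" if "0 \<le> t" for t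
  proof -
    have "(?H has_real_derivative ?D t) (at t within {0..})"
      by (rule has_derivative_integral_comp[OF _ _ A_sets that])
        (auto intro!: derivative_eq_intros continuous_intros)
    from DERIV_diff[OF this DERIV_const] show ?thesis by simp
  qed
  have decay: "?H t - r / 2 \<le> exp (- (2 / C) * (t - S)) * (?H S - r / 2)" if "S \<le> t" for t
    by (rule exp_decay_of_derivative_le[OF der D _ that]) (auto simp: S_def)
  have "((\<lambda>t. exp (- (2 / C) * (t - S)) * (?H S - r / 2)) \<longlongrightarrow> 0) at_top"
    using exp_decay_tendsto_0[of "2 / C" "exp (2 / C * S) * (?H S - r / 2)"] C(1)
    by (simp add: mult.assoc[symmetric] exp_add[symmetric] right_diff_distrib)
  then have "\<forall>\<^sub>F t in at_top. exp (- (2 / C) * (t - S)) * (?H S - r / 2) < r / 2"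
    using r by (intro order_tendstoD(2)) auto
  then show "\<forall>\<^sub>F t in at_top. ?H t < r"
    using eventually_ge_at_top[of S]
  proof eventually_elim
    case (elim t)
    then show ?case using decay[of t] by linarith
  qed
qed

text \<open>Off \<open>A\<close> the difference vanishes; on \<open>A\<close>, which has finite
  measure, mean-square convergence gives convergence in the mean through
  \<open>\<bar>y\<bar> \<le> q + 1 / q * y\<^sup>2\<close>.\<close>

lemma L1_convergence:
  "((\<lambda>t. \<integral>\<^sup>+x. ennreal \<bar>u t x - (if x \<in> A then mu else 1)\<bar> \<partial>M) \<longlongrightarrow> 0) at_top"
proof -
  let ?H = "\<lambda>t. \<integral>x. indicat_real A x * (u t x - mu)\<^sup>2 \<partial>M"
  let ?L = "\<lambda>t. \<integral>x. indicat_real A x * \<bar>u t x - mu\<bar> \<partial>M"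
  have intL: "integrable M (\<lambda>x. indicat_real A x * \<bar>u t x - mu\<bar>)" if "0 \<le> t" for t
    by (intro integrable_indicator_comp[of "\<lambda>s. \<bar>s - mu\<bar>"] continuous_intros that A_sets)
  have eq: "(\<integral>\<^sup>+x. ennreal \<bar>u t x - (if x \<in> A then mu else 1)\<bar> \<partial>M) = ennreal (?L t)" if t: "0 \<le> t" for t
  proof -
    have "(\<integral>\<^sup>+x. ennreal \<bar>u t x - (if x \<in> A then mu else 1)\<bar> \<partial>M)
        = (\<integral>\<^sup>+x. ennreal (indicat_real A x * \<bar>u t x - mu\<bar>) \<partial>M)"
      using u_eq_1[OF t] by (intro nn_integral_cong_AE) (auto elim!: eventually_mono)
    also have "\<dots> = ennreal (?L t)" by (intro nn_integral_eq_integral intL t) auto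
    finally show ?thesis .
  qed
  have "(?L \<longlongrightarrow> 0) at_top"
  proof (rule order_tendstoI)
    show "\<forall>\<^sub>F t in at_top. a < ?L t" if "a < 0" for a
      using that by (intro always_eventually allI, rule less_le_trans[OF _ integral_nonneg_AE]) auto
    fix r :: real assume r: "0 < r"
    \<comment> \<open>The term \<open>q\<close> integrates to \<open>r / 2\<close> over
      \<open>A\<close>, and \<open>?H t < q * (r / 2)\<close> bounds the other term by
      \<open>r / 2\<close>.\<close>
    define q where "q = r / (2 * measure M A)"
    have q: "0 < q" "q * measure M A = r / 2" using r measure_A_pos by (auto simp: q_def)
    have "\<forall>\<^sub>F t in at_top. ?H t < q * (r / 2)"
      using q r by (intro order_tendstoD(2)[OF deviation_tendsto_0]) auto
    then show "\<forall>\<^sub>F t in at_top. ?L t < r"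
      using eventually_ge_at_top[of 0]
    proof eventually_elim
      case (elim t)
      have intH: "integrable M (\<lambda>x. indicat_real A x * (u t x - mu)\<^sup>2)"
        by (intro integrable_indicator_comp[of "\<lambda>y. (y - mu)\<^sup>2"] continuous_intros elim A_sets)
      have *: "\<bar>y\<bar> \<le> q + 1 / q * y\<^sup>2" for y
      proof (cases "\<bar>y\<bar> \<le> q")
        case False
        then have "q * \<bar>y\<bar> \<le> \<bar>y\<bar> * \<bar>y\<bar>" by (intro mult_right_mono) auto
        then have "\<bar>y\<bar> \<le> 1 / q * y\<^sup>2" using q by (simp add: field_simps power2_eq_square)
        then show ?thesis using q by linarith
      qed (use q in \<open>simp add: add_increasing2\<close>)
      have "?L t \<le> (\<integral>x. q * indicat_real A x + 1 / q * (indicat_real A x * (u t x - mu)\<^sup>2) \<partial>M)"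
        using *
        by (intro integral_mono intL elim Bochner_Integration.integrable_add integrable_mult_right
            integrable_A intH) (simp add: indicator_def)
      also have "\<dots> = r / 2 + 1 / q * ?H t"
        using intH integrable_A q(2) by simp
      also have "\<dots> < r" using elim(1) q(1) by (simp add: field_simps)
      finally show ?case .
    qed
  qed
  then have "((\<lambda>t. ennreal (?L t)) \<longlongrightarrow> 0) at_top"
    using tendsto_ennrealI by fastforce
  then show ?thesis
    by (rule Lim_transform_eventually) (rule eventually_mono[OF eventually_ge_at_top[of 0]], simp add: eq)
qed

end

subsection \<open>Solutions in the space of bounded functions\<close>

lemma AE_bound_of_Linf_norm_less:
  assumes "Linf_norm \<Omega> f < ennreal e"
  shows "AE x in lebesgue_on \<Omega>. \<bar>f x\<bar> \<le> e"
  using esssup_AE[where f = "\<lambda>x. ennreal \<bar>f x\<bar>" and M = "lebesgue_on \<Omega>"]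
proof eventually_elim
  case (elim x)
  then have "ennreal \<bar>f x\<bar> < ennreal e" using assms by (auto simp: Linf_norm_def)
  then show ?case by (simp add: ennreal_less_iff)
qed

lemma AE_bounded_of_Linf_space:
  assumes "f \<in> Linf_space \<Omega>"
  shows "\<exists>K. AE x in lebesgue_on \<Omega>. \<bar>f x\<bar> \<le> K"
proof -
  obtain r where r: "0 \<le> r" "Linf_norm \<Omega> f = ennreal r"
    using assms by (cases "Linf_norm \<Omega> f") (auto simp: Linf_space_def)
  then have "Linf_norm \<Omega> f < ennreal (r + 1)" by (simp add: ennreal_lessI)
  then show ?thesis using AE_bound_of_Linf_norm_less by blast
qed

text \<open>Multiplying the difference quotient by \<open>s - t\<close> turns norm convergence into
  the form of \<open>u_deriv\<close>. At \<open>s = t\<close> both sides are 0.\<close>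

lemma has_Linf_derivative_AE_expansion:
  assumes der: "has_Linf_derivative \<Omega> I u v t" and e: "0 < e"
  shows "\<exists>d>0. \<forall>s\<in>I. \<bar>s - t\<bar> < d \<longrightarrow>
    (AE x in lebesgue_on \<Omega>. \<bar>u s x - u t x - (s - t) * v x\<bar> \<le> e * \<bar>s - t\<bar>)"
proof -
  have "((\<lambda>s. Linf_norm \<Omega> (\<lambda>x. (u s x - u t x) / (s - t) - v x)) \<longlongrightarrow> 0) (at t within I)"
    using der by (simp add: has_Linf_derivative_def)
  then have "\<forall>\<^sub>F s in at t within I. Linf_norm \<Omega> (\<lambda>x. (u s x - u t x) / (s - t) - v x) < ennreal e"
    using e by (intro order_tendstoD(2)) auto
  then obtain d where d: "d > 0" "\<And>s. s \<in> I \<Longrightarrow> s \<noteq> t \<Longrightarrow> dist s t < d \<Longrightarrow>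
      Linf_norm \<Omega> (\<lambda>x. (u s x - u t x) / (s - t) - v x) < ennreal e"
    unfolding eventually_at by blast
  have "AE x in lebesgue_on \<Omega>. \<bar>u s x - u t x - (s - t) * v x\<bar> \<le> e * \<bar>s - t\<bar>"
    if s: "s \<in> I" "\<bar>s - t\<bar> < d" for s
  proof (cases "s = t")
    case False
    from AE_bound_of_Linf_norm_less[OF d(2)[OF s(1) False]] s(2)
    have "AE x in lebesgue_on \<Omega>. \<bar>(u s x - u t x) / (s - t) - v x\<bar> \<le> e"
      by (simp add: dist_real_def)
    then show ?thesis
    proof eventually_elim
      case (elim x)
      have "u s x - u t x - (s - t) * v x = ((u s x - u t x) / (s - t) - v x) * (s - t)"
        using False by (simp add: field_simps)
      then show ?case using mult_right_mono[OF elim, of "\<bar>s - t\<bar>"] by (simp only: abs_mult)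
    qed
  qed simp
  with d(1) show ?thesis by blast
qed

section \<open>The omega-limit set and the two cases\<close>

text \<open>By the triangle inequality along the sequence, convergence as time tends to infinity
  forces every sequential limit to agree with \<open>\<phi>\<close> almost everywhere. Conversely,
  the integer times realise \<open>\<phi>\<close>.\<close>

lemma omega_limit_eq_singleton:
  assumes meas: "\<And>t. 0 \<le> t \<Longrightarrow> u t \<in> borel_measurable (lebesgue_on \<Omega>)"
    and int: "integrable (lebesgue_on \<Omega>) \<phi>"
    and lim: "((\<lambda>t. \<integral>\<^sup>+x. ennreal \<bar>u t x - \<phi> x\<bar> \<partial>lebesgue_on \<Omega>) \<longlongrightarrow> 0) at_top"
  shows "omega_limit \<Omega> u = {L1_class \<Omega> \<phi>}"
proof
  show "{L1_class \<Omega> \<phi>} \<subseteq> omega_limit \<Omega> u"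
    unfolding omega_limit_def
    using int filterlim_compose[OF lim filterlim_real_sequentially] filterlim_real_sequentially
    by (auto intro!: exI[of _ \<phi>] exI[of _ "\<lambda>n. real n"])
  show "omega_limit \<Omega> u \<subseteq> {L1_class \<Omega> \<phi>}"
  proof
    fix c assume "c \<in> omega_limit \<Omega> u"
    then obtain \<psi> t where c: "c = L1_class \<Omega> \<psi>" and \<psi>: "integrable (lebesgue_on \<Omega>) \<psi>"
      and t: "\<And>n. 0 \<le> t n" "filterlim t at_top sequentially"
      and lim': "(\<lambda>n. \<integral>\<^sup>+x. ennreal \<bar>u (t n) x - \<psi> x\<bar> \<partial>lebesgue_on \<Omega>) \<longlonglongrightarrow> 0"
      unfolding omega_limit_def by blast
    let ?N = "\<lambda>f. \<integral>\<^sup>+x. ennreal \<bar>f x\<bar> \<partial>lebesgue_on \<Omega>"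
    have "(\<lambda>n. ?N (\<lambda>x. u (t n) x - \<psi> x) + ?N (\<lambda>x. u (t n) x - \<phi> x)) \<longlonglongrightarrow> 0 + 0"
      by (intro tendsto_add lim' filterlim_compose[OF lim t(2)])
    moreover have "?N (\<lambda>x. \<psi> x - \<phi> x) \<le> ?N (\<lambda>x. u (t n) x - \<psi> x) + ?N (\<lambda>x. u (t n) x - \<phi> x)" for n
    proof -
      have "?N (\<lambda>x. \<psi> x - \<phi> x)
          \<le> (\<integral>\<^sup>+x. ennreal \<bar>u (t n) x - \<psi> x\<bar> + ennreal \<bar>u (t n) x - \<phi> x\<bar> \<partial>lebesgue_on \<Omega>)"
        by (intro nn_integral_mono) (simp add: ennreal_plus[symmetric] del: ennreal_plus)
      also have "\<dots> = ?N (\<lambda>x. u (t n) x - \<psi> x) + ?N (\<lambda>x. u (t n) x - \<phi> x)"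
        using meas[OF t(1)[of n]] int[THEN borel_measurable_integrable] \<psi>[THEN borel_measurable_integrable]
        by (intro nn_integral_add; measurable)
      finally show ?thesis .
    qed
    ultimately have "?N (\<lambda>x. \<psi> x - \<phi> x) \<le> 0"
      by (intro LIMSEQ_le_const[where X = "\<lambda>n. ?N (\<lambda>x. u (t n) x - \<psi> x) + ?N (\<lambda>x. u (t n) x - \<phi> x)"]) auto
    then have "AE x in lebesgue_on \<Omega>. ennreal \<bar>\<psi> x - \<phi> x\<bar> = 0"
      using int \<psi> by (subst (asm) le_zero_eq, subst (asm) nn_integral_0_iff_AE) auto
    then have eq: "AE x in lebesgue_on \<Omega>. \<psi> x = \<phi> x" by eventually_elim simp
    have "L1_class \<Omega> \<psi> = L1_class \<Omega> \<phi>"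
      unfolding L1_class_def using eq by (auto elim: AE_mp[OF _ AE_mp[OF eq]])
    then show "c \<in> {L1_class \<Omega> \<phi>}" using c by simp
  qed
qed

lemma C1_differentiable_on_UNIV_real:
  fixes f :: "real \<Rightarrow> real"
  assumes "f C1_differentiable_on UNIV"
  obtains f' where "\<And>s. (f has_real_derivative f' s) (at s)" "continuous_on UNIV f'"
  using assms unfolding C1_differentiable_on_def has_real_derivative_iff_has_vector_derivative by auto

theorem theorem5p1:
  fixes \<Omega> :: "(real ^ 'n::finite) set"
    and p g :: "real \<Rightarrow> real"
    and u0 :: "real ^ 'n \<Rightarrow> real"
    and u :: "real \<Rightarrow> real ^ 'n \<Rightarrow> real"
  assumes "open \<Omega>" and "bounded \<Omega>"
    and "p C1_differentiable_on UNIV" and "strict_mono p"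
    and "g C1_differentiable_on UNIV"
    and "g 0 = 0" and "g 1 = 0"
    and "\<forall>s. 0 < s \<and> s < 1 \<longrightarrow> 0 < g s"
    and "\<forall>s. s < 0 \<or> 1 < s \<longrightarrow> g s < 0"
    and "u0 \<in> Linf_space \<Omega>"
    and "solution_P \<Omega> p g u0 \<infinity> u"
  shows "((AE x in lebesgue_on \<Omega>. 1 \<le> u0 x) \<and> \<not> (AE x in lebesgue_on \<Omega>. u0 x = 1) \<longrightarrow>
      (\<exists>\<phi>. omega_limit \<Omega> u = {L1_class \<Omega> \<phi>} \<and>
        (\<exists>A1 \<mu>. A1 \<subseteq> \<Omega> \<and> A1 \<in> sets lebesgue \<and> 1 < \<mu> \<and>
          \<phi> = (\<lambda>x. \<mu> * indicator A1 x + indicator (\<Omega> - A1) x)))) \<and>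
    ((AE x in lebesgue_on \<Omega>. u0 x \<le> 0) \<and> \<not> (AE x in lebesgue_on \<Omega>. u0 x = 0) \<longrightarrow>
      (\<exists>\<psi>. omega_limit \<Omega> u = {L1_class \<Omega> \<psi>} \<and>
        (\<exists>A1 \<xi>. A1 \<subseteq> \<Omega> \<and> A1 \<in> sets lebesgue \<and> \<xi> < 0 \<and>
          \<psi> = (\<lambda>x. \<xi> * indicator A1 x))))"
proof -
  let ?M = "lebesgue_on \<Omega>"
  obtain p' where p': "\<And>s. (p has_real_derivative p' s) (at s)" "continuous_on UNIV p'"
    using C1_differentiable_on_UNIV_real[OF assms(3)] by blast
  obtain g' where g': "\<And>s. (g has_real_derivative g' s) (at s)" "continuous_on UNIV g'"
    using C1_differentiable_on_UNIV_real[OF assms(5)] by blast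
  have \<Omega>: "\<Omega> \<in> sets lebesgue" "\<Omega> \<in> lmeasurable"
    using assms(1,2) by (auto intro: lmeasurable_open)
  interpret finite_measure ?M using finite_measure_lebesgue_on[OF \<Omega>(2)] .
  have T: "time_interval \<infinity> = {0..}" by (auto simp: time_interval_def)
  have u_space: "u t \<in> Linf_space \<Omega>" if "0 \<le> t" for t
    using assms(11) that unfolding solution_P_def C1_Linf_def T by auto
  then have meas: "u t \<in> borel_measurable ?M" if "0 \<le> t" for t
    using that by (simp add: Linf_space_def)
  have bdd: "\<exists>K. AE x in ?M. \<bar>u t x\<bar> \<le> K" if "0 \<le> t" for t
    using AE_bounded_of_Linf_space[OF u_space[OF that]] .
  have nz: "(\<integral>x. g (u t x) \<partial>?M) \<noteq> 0" if "0 \<le> t" for t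
    using assms(11) that unfolding solution_P_def T by auto
  have der: "\<exists>d>0. \<forall>s\<ge>0. \<bar>s - t\<bar> < d \<longrightarrow>
      (AE x in ?M. \<bar>u s x - u t x - (s - t) * F_op \<Omega> p g (u t) x\<bar> \<le> e * \<bar>s - t\<bar>)"
    if "0 \<le> t" "0 < e" for t e
    using has_Linf_derivative_AE_expansion[of \<Omega> "{0..}" u _ t e] assms(11) that
    unfolding solution_P_def T by (auto simp: Ball_def)
  have init: "AE x in ?M. u 0 x = u0 x" using assms(11) unfolding solution_P_def by blast
  have sets: "A \<subseteq> \<Omega> \<and> A \<in> sets lebesgue" if "A \<in> sets ?M" for A
    using that \<Omega>(1) by (simp add: sets_restrict_space_iff)
  have step_int: "integrable ?M (\<lambda>x. a * indicator A x + b * indicator (\<Omega> - A) x)"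
    if A: "A \<in> sets ?M" for A and a b :: real
  proof -
    have "\<Omega> - A \<in> sets ?M" using sets.compl_sets[OF A] by simp
    then show ?thesis using A
      by (intro Bochner_Integration.integrable_add integrable_mult_right integrable_real_indicator)
        (auto simp: emeasure_eq_measure)
  qed
  show ?thesis
  proof (intro conjI impI; elim conjE)
    assume i: "AE x in ?M. 1 \<le> u0 x" "\<not> (AE x in ?M. u0 x = 1)"
    \<comment> \<open>\<open>F_op\<close> is the source term of the locale with the factor
      \<open>g (u t x)\<close> multiplied out.\<close>
    interpret nonlocal_flow ?M u g g' p p'
      "\<lambda>t. (\<integral>x. g (u t x) * p (u t x) \<partial>?M) / (\<integral>x. g (u t x) \<partial>?M)"
      "\<lambda>t x. g (u t x) * (p (u t x) - (\<integral>x. g (u t x) * p (u t x) \<partial>?M) / (\<integral>x. g (u t x) \<partial>?M))"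
    proof unfold_locales
      show "AE x in ?M. 1 \<le> u 0 x" using i(1) init by eventually_elim simp
      show "\<not> (AE x in ?M. u 0 x = 1)"
      proof
        assume "AE x in ?M. u 0 x = 1"
        then have "AE x in ?M. u0 x = 1" using init by eventually_elim simp
        then show False using i(2) by blast
      qed
      show "\<exists>d>0. \<forall>s\<ge>0. \<bar>s - t\<bar> < d \<longrightarrow> (AE x in ?M. \<bar>u s x - u t x - (s - t) *
          (g (u t x) * (p (u t x) - (\<integral>x. g (u t x) * p (u t x) \<partial>?M) / (\<integral>x. g (u t x) \<partial>?M)))\<bar> \<le> e * \<bar>s - t\<bar>)"
        if "0 \<le> t" "0 < e" for t e
        using der[OF that] by (simp add: F_op_def right_diff_distrib)
    qed (use p' g' assms meas bdd nz in auto)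
    let ?\<phi> = "\<lambda>x. mu * indicator A x + indicator (\<Omega> - A) x :: real"
    have "omega_limit \<Omega> u = {L1_class \<Omega> ?\<phi>}"
    proof (rule omega_limit_eq_singleton[OF meas])
      show "integrable ?M ?\<phi>" using step_int[OF A_sets, of mu 1] by simp
      have "(\<integral>\<^sup>+x. ennreal \<bar>u t x - ?\<phi> x\<bar> \<partial>?M) = (\<integral>\<^sup>+x. ennreal \<bar>u t x - (if x \<in> A then mu else 1)\<bar> \<partial>?M)" for t
        by (intro nn_integral_cong) (auto simp: indicator_def)
      then show "((\<lambda>t. \<integral>\<^sup>+x. ennreal \<bar>u t x - ?\<phi> x\<bar> \<partial>?M) \<longlongrightarrow> 0) at_top"
        using L1_convergence by simp
    qed
    then show "\<exists>\<phi>. omega_limit \<Omega> u = {L1_class \<Omega> \<phi>} \<and>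
        (\<exists>A1 \<mu>. A1 \<subseteq> \<Omega> \<and> A1 \<in> sets lebesgue \<and> 1 < \<mu> \<and>
          \<phi> = (\<lambda>x. \<mu> * indicator A1 x + indicator (\<Omega> - A1) x))"
      using sets[OF A_sets] mu_gt_1 by blast
  next
    assume ii: "AE x in ?M. u0 x \<le> 0" "\<not> (AE x in ?M. u0 x = 0)"
    \<comment> \<open>With \<open>w = 1 - u\<close> one has \<open>?g w = g u\<close> and
      \<open>?p w = - p u\<close>, so the source term for \<open>w\<close> is \<open>- F_op\<close>,
      matching the time derivative of \<open>1 - u\<close>. The minus sign in \<open>?p\<close>
      keeps it increasing.\<close>
    let ?w = "\<lambda>t x. 1 - u t x" and ?g = "\<lambda>s. g (1 - s)" and ?p = "\<lambda>s. - p (1 - s)"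
    have refl_deriv: "((\<lambda>s. 1 - s) has_real_derivative - 1) (at s)" for s :: real
      by (auto intro!: derivative_eq_intros)
    interpret nonlocal_flow ?M ?w ?g "\<lambda>s. - g' (1 - s)" ?p "\<lambda>s. p' (1 - s)"
      "\<lambda>t. (\<integral>x. ?g (?w t x) * ?p (?w t x) \<partial>?M) / (\<integral>x. ?g (?w t x) \<partial>?M)"
      "\<lambda>t x. ?g (?w t x) * (?p (?w t x) - (\<integral>x. ?g (?w t x) * ?p (?w t x) \<partial>?M) / (\<integral>x. ?g (?w t x) \<partial>?M))"
    proof unfold_locales
      show "(?g has_real_derivative - g' (1 - s)) (at s)" for s
        using DERIV_chain2[OF g'(1) refl_deriv] by simp
      show "(?p has_real_derivative p' (1 - s)) (at s)" for s
        using DERIV_minus[OF DERIV_chain2[OF p'(1) refl_deriv]] by simp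
      show "continuous_on UNIV (\<lambda>s. - g' (1 - s))" "continuous_on UNIV (\<lambda>s. p' (1 - s))"
        by (auto intro!: continuous_intros continuous_on_compose2[OF g'(2)] continuous_on_compose2[OF p'(2)])
      show "strict_mono ?p" using assms(4) by (auto simp: strict_mono_def)
      show "?w t \<in> borel_measurable ?M" if "0 \<le> t" for t using meas[OF that] by measurable
      show "\<exists>K. AE x in ?M. \<bar>?w t x\<bar> \<le> K" if t: "0 \<le> t" for t
      proof -
        obtain K where "AE x in ?M. \<bar>u t x\<bar> \<le> K" using bdd[OF t] by blast
        then have "AE x in ?M. \<bar>?w t x\<bar> \<le> 1 + K" by eventually_elim linarith
        then show ?thesis by blast
      qed
      show "AE x in ?M. 1 \<le> ?w 0 x" using ii(1) init by eventually_elim simp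
      show "\<not> (AE x in ?M. ?w 0 x = 1)"
      proof
        assume "AE x in ?M. ?w 0 x = 1"
        then have "AE x in ?M. u0 x = 0" using init by eventually_elim simp
        then show False using ii(2) by blast
      qed
      have eq: "?g (?w t x) * (?p (?w t x) - (\<integral>x. ?g (?w t x) * ?p (?w t x) \<partial>?M) / (\<integral>x. ?g (?w t x) \<partial>?M))
          = - F_op \<Omega> p g (u t) x" for t x
        by (simp add: F_op_def algebra_simps)
      have "\<bar>?w s x - ?w t x - (s - t) * (- F_op \<Omega> p g (u t) x)\<bar>
          = \<bar>u s x - u t x - (s - t) * F_op \<Omega> p g (u t) x\<bar>" for s t x
        by (simp add: algebra_simps abs_if)
      then show "\<exists>d>0. \<forall>s\<ge>0. \<bar>s - t\<bar> < d \<longrightarrow> (AE x in ?M. \<bar>?w s x - ?w t x - (s - t) *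
          (?g (?w t x) * (?p (?w t x) - (\<integral>x. ?g (?w t x) * ?p (?w t x) \<partial>?M) / (\<integral>x. ?g (?w t x) \<partial>?M)))\<bar>
          \<le> e * \<bar>s - t\<bar>)" if "0 \<le> t" "0 < e" for t e
        using der[OF that] unfolding eq by simp
    qed (use assms nz in auto)
    \<comment> \<open>\<open>?w\<close> tends to \<open>mu\<close> on \<open>A\<close> and to 1
      elsewhere, hence \<open>u\<close> tends to \<open>1 - mu\<close> on \<open>A\<close> and to 0
      elsewhere.\<close>
    let ?\<psi> = "\<lambda>x. (1 - mu) * indicator A x :: real"
    have "omega_limit \<Omega> u = {L1_class \<Omega> ?\<psi>}"
    proof (rule omega_limit_eq_singleton[OF meas])
      show "integrable ?M ?\<psi>" using step_int[OF A_sets, of "1 - mu" 0] by simp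
      have "(\<integral>\<^sup>+x. ennreal \<bar>u t x - ?\<psi> x\<bar> \<partial>?M) = (\<integral>\<^sup>+x. ennreal \<bar>?w t x - (if x \<in> A then mu else 1)\<bar> \<partial>?M)" for t
        by (intro nn_integral_cong) (auto simp: indicator_def)
      then show "((\<lambda>t. \<integral>\<^sup>+x. ennreal \<bar>u t x - ?\<psi> x\<bar> \<partial>?M) \<longlongrightarrow> 0) at_top"
        using L1_convergence by simp
    qed
    moreover have "1 - mu < 0" using mu_gt_1 by simp
    ultimately show "\<exists>\<psi>. omega_limit \<Omega> u = {L1_class \<Omega> \<psi>} \<and>
        (\<exists>A1 \<xi>. A1 \<subseteq> \<Omega> \<and> A1 \<in> sets lebesgue \<and> \<xi> < 0 \<and> \<psi> = (\<lambda>x. \<xi> * indicator A1 x))"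
      using sets[OF A_sets] by blast
  qed
qed

end
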